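(* Suppose that the skew product $F:\Sigma\to\Sigma$, $F(\underline x,y)=(\sigma(\underline x),G(\underline x,y))$, satisfies (G1) and (G2), and let $\mu_0$ be the unique $F$-invariant probability measure in $S^\infty$. Then there exists a constant $0<\tau_3<1$ such that, for every $\mathcal F_0$-measurable function $\psi\in L^1_{\mu_0}(\mathcal F_0)$ and every Lipschitz function $\varphi\in\mathrm H(\Sigma)$, $$\left|\int_\Sigma(\psi\circ F^n)\,\varphi\,d\mu_0-\int_\Sigma\psi\,d\mu_0\int_\Sigma\varphi\,d\mu_0\right|\le\tau_3^n\,D(\psi,\varphi)\qquad\forall n\ge1,$$ where $D(\psi,\varphi)>0$ is a constant (independent of $n$) depending on $\psi$ and $\varphi$.
   Context: $A$ is an aperiodic $N\times N$ matrix with entries in $\{0,1\}$, $\Sigma_A^+=\{\underline x=(x_i)_{i\ge 0}: x_i\in\{1,\dots,N\},\ A_{x_i,x_{i+1}}=1\ \forall i\ge 0\}$, $\theta\in(0,1)$ is fixed, $d_\theta(\underline x,\underline y)=\sum_{i\ge0}\theta^i(1-\delta_{x_i,y_i})$ (Kronecker delta), $\sigma$ is the left shift and $m$ is a fixed $\sigma$-invariant Markov measure on $\Sigma_A^+$. $\mathcal F_\theta(\Sigma_A^+)$ is the space of $d_\theta$-Lipschitz real functions. $(K,d)$ is a compact metric space with $\operatorname{diam}K=1$, $\Sigma=\Sigma_A^+\times K$ (product metric $d_\theta+d$). $\mathrm H(\Sigma)$ is the space of real Lipschitz functions on $\Sigma$. $G:\Sigma\to K$ is measurable. (G1) There is $0<\alpha<1$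 such that for $m$-a.e. $\underline x$: $d(G(\underline x,y_1),G(\underline x,y_2))\le\alpha\, d(y_1,y_2)$ for all $y_1,y_2\in K$. (G2) For each $y\in K$ there is $k_y\ge0$ with $d(G(\underline x^1,y),G(\underline x^2,y))\le k_y d_\theta(\underline x^1,\underline x^2)$ for all $\underline x^1,\underline x^2$, and $\sup_{y}k_y<\infty$. The $\sigma$-algebra $\mathcal F_0$: let $\mathcal G$ be a countable generator of the Borel $\sigma$-algebra of $\Sigma_A^+$, $\mathcal A$ the algebra generated by $\mathcal G$, and $\mathcal A\times K=\{B\times K:B\in\mathcal A\}$; $\mathcal F_0$ is the $\sigma$-algebra of subsets of $\Sigma$ generated by $\mathcal A\times K$. $L^1_{\mu_0}(\mathcal F_0)$ is the set of $\mathcal F_0$-measurable $\mu_0$-integrable functions. $\mathcal{AB}_m$ is the set of finite signed Borel measures $\mu$ on $\Sigma$ with $\pi_1^*\mu^\pm\ll m$ (push-forwards of the Jordan parts under $\pi_1:\Sigma\to\Sigma_A^+$). For positive $\mu\in\mathcal{AB}_m$ with Rokhlin disintegration $(\{\mu_\gamma\},\phi_1m)$ along the fibers $\gamma_{\underline x}=\{\underline x\}\times K$ ($\mu_\gamma$ probability measures, $\phi_1=d(\pi_1^*\mu)/dm$), $\mu|_{\gamma_{\underline x}}$ is the measure on $K$ obtained by pushing $\phi_1(\underline x)\mu_{\gamma_{\underline x}}$ forward under $(\underline x,y)\mapsto y$; for signed $\mu$, $\mu|_\gamma=\mu^+|_\gamma-\mu^-|_\gamma$. For a signed measure $\nu$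 on $K$, $\|\nu\|_W=\sup\{|\int g\,d\nu|:\operatorname{Lip}(g)\le1,\|g\|_\infty\le1\}$. $\|\mu\|_\infty=\operatorname{ess\,sup}_{\underline x}\|\mu|_{\gamma_{\underline x}}\|_W$ (w.r.t. $m$), and $S^\infty=\{\mu\in\mathcal{AB}_m:\|\mu\|_\infty<\infty,\ d(\pi_1^*\mu)/dm\in\mathcal F_\theta(\Sigma_A^+)\}$. It is known that under (G1) there is a unique $F$-invariant probability measure $\mu_0\in S^\infty$. *)

theory Defs
  imports "HOL-Probability.Probability"
begin

section \<open>One-sided subshifts of finite type\<close>

text \<open>The alphabet \<open>{1,\<dots>,N}\<close> is an arbitrary finite type \<open>'n\<close>. The power class
  operation on vectors is componentwise, so matrix powers are iterates of \<open>(**)\<close>.\<close>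

definition matpow :: "nat^'n^'n \<Rightarrow> nat \<Rightarrow> nat^'n^'n" where
  "matpow A k = (((**) A) ^^ k) (mat 1)"

definition aperiodic :: "nat^'n^'n \<Rightarrow> bool" where
  "aperiodic A \<longleftrightarrow> (\<exists>k\<ge>1. \<forall>i j. matpow A k $ i $ j > 0)"

definition shift_space :: "nat^'n^'n \<Rightarrow> (nat \<Rightarrow> 'n) set" where
  "shift_space A = {x. \<forall>i. A $ x i $ x (Suc i) = 1}"

definition shift :: "(nat \<Rightarrow> 'n) \<Rightarrow> nat \<Rightarrow> 'n" where
  "shift x = (\<lambda>i. x (Suc i))"

definition d_theta :: "real \<Rightarrow> (nat \<Rightarrow> 'n) \<Rightarrow> (nat \<Rightarrow> 'n) \<Rightarrow> real" where
  "d_theta \<theta> x y = (\<Sum>i. \<theta> ^ i * (1 - (if x i = y i then 1 else 0)))"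

definition shift_metric :: "real \<Rightarrow> nat^'n^'n \<Rightarrow> (nat \<Rightarrow> 'n) metric" where
  "shift_metric \<theta> A = metric (shift_space A, d_theta \<theta>)"

definition d_sum :: "real \<Rightarrow> (nat \<Rightarrow> 'n) \<times> 'k::metric_space \<Rightarrow> (nat \<Rightarrow> 'n) \<times> 'k \<Rightarrow> real" where
  "d_sum \<theta> p q = d_theta \<theta> (fst p) (fst q) + dist (snd p) (snd q)"

definition skew_metric :: "real \<Rightarrow> nat^'n^'n \<Rightarrow> ((nat \<Rightarrow> 'n) \<times> 'k::metric_space) metric" where
  "skew_metric \<theta> A = metric (shift_space A \<times> UNIV, d_sum \<theta>)"

text \<open>The type \<open>'a metric\<close> is a subtype, so the two definitions above are meaningful only
  because of the following facts.\<close>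

lemma summable_d_theta:
  fixes \<theta> :: real
  assumes "0 < \<theta>" "\<theta> < 1"
  shows "summable (\<lambda>i. \<theta> ^ i * (1 - (if x i = y i then 1 else 0)))"
  by (rule summable_comparison_test'[where g = "\<lambda>i. \<theta> ^ i" and N = 0])
     (use assms in \<open>auto simp: summable_geometric\<close>)

lemma Metric_space_d_theta:
  fixes \<theta> :: real and S :: "(nat \<Rightarrow> 'n) set"
  assumes th: "0 < \<theta>" "\<theta> < 1"
  shows "Metric_space S (d_theta \<theta>)"
proof
  fix x y z :: "nat \<Rightarrow> 'n"
  note summ = summable_d_theta[OF th]
  have nonneg: "0 \<le> \<theta> ^ i * (1 - (if u i = v i then 1 else 0))" for i and u v :: "nat \<Rightarrow> 'n"
    using th by auto
  show "0 \<le> d_theta \<theta> x y"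
    unfolding d_theta_def by (rule suminf_nonneg[OF summ[of x y] nonneg[of _ x y]])
  show "d_theta \<theta> x y = d_theta \<theta> y x"
    unfolding d_theta_def by (simp add: eq_commute)
  show "d_theta \<theta> x y = 0 \<longleftrightarrow> x = y"
  proof
    assume "d_theta \<theta> x y = 0"
    then have "\<forall>i. \<theta> ^ i * (1 - (if x i = y i then 1 else 0)) = 0"
      unfolding d_theta_def using suminf_eq_zero_iff[OF summ[of x y] nonneg[of _ x y]] by simp
    then show "x = y"
      using th by (auto simp: fun_eq_iff split: if_splits)
  qed (simp add: d_theta_def)
  show "d_theta \<theta> x z \<le> d_theta \<theta> x y + d_theta \<theta> y z"
    unfolding d_theta_def suminf_add[OF summ summ]
    by (rule suminf_le[OF _ summ summable_add[OF summ summ]])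
       (use th in \<open>auto simp: zero_le_power\<close>)
qed

lemma Metric_space_d_sum:
  fixes S :: "((nat \<Rightarrow> 'n) \<times> 'k::metric_space) set"
  assumes "0 < \<theta>" "\<theta> < 1"
  shows "Metric_space S (d_sum \<theta>)"
proof -
  interpret S: Metric_space UNIV "d_theta \<theta> :: (nat \<Rightarrow> 'n) \<Rightarrow> _"
    by (rule Metric_space_d_theta[OF assms])
  show ?thesis
  proof
    fix p q r :: "(nat \<Rightarrow> 'n) \<times> 'k"
    show "0 \<le> d_sum \<theta> p q" by (simp add: d_sum_def)
    show "d_sum \<theta> p q = d_sum \<theta> q p" by (simp add: d_sum_def S.commute dist_commute)
    show "d_sum \<theta> p q = 0 \<longleftrightarrow> p = q"
      by (simp add: d_sum_def add_nonneg_eq_0_iff prod_eq_iff)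
    show "d_sum \<theta> p r \<le> d_sum \<theta> p q + d_sum \<theta> q r"
      using S.triangle[of "fst p" "fst q" "fst r"] dist_triangle[of "snd p" "snd r" "snd q"]
      by (simp add: d_sum_def)
  qed
qed

definition metric_borel :: "'a metric \<Rightarrow> 'a measure" where
  "metric_borel X = sigma (mspace X) {U. openin (mtopology_of X) U}"

definition lipschitz_functions :: "'a metric \<Rightarrow> ('a \<Rightarrow> real) set" where
  "lipschitz_functions X = {f. Lipschitz_continuous_map X euclidean_metric f}"

text \<open>Markov measures: \<open>P\<close> is a stochastic matrix compatible with \<open>A\<close>, i.e. its positive entries
  are exactly the admissible transitions, and \<open>p\<close> is the initial distribution.\<close>

definition markov_measure :: "real \<Rightarrow> nat^'n^'n \<Rightarrow> (nat \<Rightarrow> 'n) measure \<Rightarrow> bool" where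
  "markov_measure \<theta> A m \<longleftrightarrow>
     sets m = sets (metric_borel (shift_metric \<theta> A)) \<and> prob_space m \<and>
     (\<exists>(P :: real^'n^'n) (p :: real^'n).
        (\<forall>i j. P $ i $ j \<ge> 0) \<and> (\<forall>i. (\<Sum>j\<in>UNIV. P $ i $ j) = 1) \<and>
        (\<forall>i j. P $ i $ j > 0 \<longleftrightarrow> A $ i $ j = 1) \<and>
        (\<forall>i. p $ i \<ge> 0) \<and> (\<Sum>i\<in>UNIV. p $ i) = 1 \<and>
        (\<forall>w n. measure m {x \<in> shift_space A. \<forall>i\<le>n. x i = w i} =
                 p $ w 0 * (\<Prod>i<n. P $ w i $ w (Suc i))))"

section \<open>Finite signed measures\<close>

text \<open>A finite signed measure on the measurable sets of \<open>M\<close> is a countably additive real-valued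
  set function; its values outside \<open>sets M\<close> play no role. The positive Jordan part is
  \<open>\<nu>\<^sup>+(E) = sup {\<nu>(B) : B \<subseteq> E measurable}\<close>, and \<open>\<nu>\<^sup>- = (-\<nu>)\<^sup>+\<close>.\<close>

definition signed_measure :: "'a measure \<Rightarrow> ('a set \<Rightarrow> real) \<Rightarrow> bool" where
  "signed_measure M \<nu> \<longleftrightarrow>
     (\<forall>E. range E \<subseteq> sets M \<longrightarrow> disjoint_family E \<longrightarrow> (\<lambda>i::nat. \<nu> (E i)) sums \<nu> (\<Union>i. E i))"

definition pos_part :: "'a measure \<Rightarrow> ('a set \<Rightarrow> real) \<Rightarrow> 'a measure" where
  "pos_part M \<nu> = measure_of (space M) (sets M) (\<lambda>E. SUP B\<in>{B \<in> sets M. B \<subseteq> E}. ennreal (\<nu> B))"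

definition neg_part :: "'a measure \<Rightarrow> ('a set \<Rightarrow> real) \<Rightarrow> 'a measure" where
  "neg_part M \<nu> = pos_part M (\<lambda>B. - \<nu> B)"

definition signed_integral :: "'a measure \<Rightarrow> ('a set \<Rightarrow> real) \<Rightarrow> ('a \<Rightarrow> real) \<Rightarrow> real" where
  "signed_integral M \<nu> g = integral\<^sup>L (pos_part M \<nu>) g - integral\<^sup>L (neg_part M \<nu>) g"

definition W_norm :: "('k::metric_space set \<Rightarrow> real) \<Rightarrow> ereal" where
  "W_norm \<nu> = (SUP g\<in>{g. 1-lipschitz_on UNIV g \<and> (\<forall>y. \<bar>g y\<bar> \<le> 1)}.
                 ereal \<bar>signed_integral borel \<nu> g\<bar>)"

section \<open>The space \<open>S\<^sup>\<infinity>\<close>\<close>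

abbreviation skew_borel :: "real \<Rightarrow> nat^'n^'n \<Rightarrow> ((nat \<Rightarrow> 'n) \<times> 'k::metric_space) measure" where
  "skew_borel \<theta> A \<equiv> metric_borel (skew_metric \<theta> A)"

definition AB ::
  "real \<Rightarrow> nat^'n^'n \<Rightarrow> (nat \<Rightarrow> 'n) measure \<Rightarrow> (((nat \<Rightarrow> 'n) \<times> 'k::metric_space) set \<Rightarrow> real) set" where
  "AB \<theta> A m = {\<mu>. signed_measure (skew_borel \<theta> A) \<mu> \<and>
     absolutely_continuous m (distr (pos_part (skew_borel \<theta> A) \<mu>) m fst) \<and>
     absolutely_continuous m (distr (neg_part (skew_borel \<theta> A) \<mu>) m fst)}"

text \<open>For a positive measure \<open>\<mu>\<close>, \<open>marginal_density m \<mu>\<close> is \<open>\<phi>\<^sub>1 = d(\<pi>\<^sub>1\<^sup>*\<mu>)/dm\<close>, and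
  \<open>disintegration\<close> says that \<open>\<kappa> x\<close> are the conditional probabilities of \<open>\<mu>\<close> on the fibers
  \<open>{x} \<times> K\<close>. Off the support of \<open>\<phi>\<^sub>1 m\<close> the probability \<open>\<kappa> x\<close> is arbitrary.\<close>

definition marginal_density ::
  "(nat \<Rightarrow> 'n) measure \<Rightarrow> ((nat \<Rightarrow> 'n) \<times> 'k::metric_space) measure \<Rightarrow> (nat \<Rightarrow> 'n) \<Rightarrow> ennreal" where
  "marginal_density m \<mu> = RN_deriv m (distr \<mu> m fst)"

definition disintegration ::
  "(nat \<Rightarrow> 'n) measure \<Rightarrow> ((nat \<Rightarrow> 'n) \<times> 'k::metric_space) measure \<Rightarrow>
     ((nat \<Rightarrow> 'n) \<Rightarrow> ((nat \<Rightarrow> 'n) \<times> 'k) measure) \<Rightarrow> bool" where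
  "disintegration m \<mu> \<kappa> \<longleftrightarrow>
     \<kappa> \<in> measurable m (prob_algebra \<mu>) \<and>
     (AE x in distr \<mu> m fst. emeasure (\<kappa> x) ({x} \<times> UNIV) = 1) \<and>
     (\<forall>E\<in>sets \<mu>. emeasure \<mu> E = (\<integral>\<^sup>+x. emeasure (\<kappa> x) E * marginal_density m \<mu> x \<partial>m))"

text \<open>Disintegrations are unique up to null sets, so the choice made here affects the restrictions
  to the fibers only on an \<open>m\<close>-null set and does not affect \<open>norm_inf\<close>.\<close>

definition fiber_restriction_pos ::
  "(nat \<Rightarrow> 'n) measure \<Rightarrow> ((nat \<Rightarrow> 'n) \<times> 'k::metric_space) measure \<Rightarrow> (nat \<Rightarrow> 'n) \<Rightarrow> 'k measure" where
  "fiber_restriction_pos m \<mu> x =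
     distr (scale_measure (marginal_density m \<mu> x) ((SOME \<kappa>. disintegration m \<mu> \<kappa>) x)) borel snd"

definition fiber_restriction ::
  "real \<Rightarrow> nat^'n^'n \<Rightarrow> (nat \<Rightarrow> 'n) measure \<Rightarrow> (((nat \<Rightarrow> 'n) \<times> 'k::metric_space) set \<Rightarrow> real) \<Rightarrow>
     (nat \<Rightarrow> 'n) \<Rightarrow> 'k set \<Rightarrow> real" where
  "fiber_restriction \<theta> A m \<mu> x B =
     measure (fiber_restriction_pos m (pos_part (skew_borel \<theta> A) \<mu>) x) B -
     measure (fiber_restriction_pos m (neg_part (skew_borel \<theta> A) \<mu>) x) B"

definition norm_inf ::
  "real \<Rightarrow> nat^'n^'n \<Rightarrow> (nat \<Rightarrow> 'n) measure \<Rightarrow> (((nat \<Rightarrow> 'n) \<times> 'k::metric_space) set \<Rightarrow> real) \<Rightarrow> ereal" where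
  "norm_inf \<theta> A m \<mu> = esssup m (\<lambda>x. W_norm (fiber_restriction \<theta> A m \<mu> x))"

definition S_inf ::
  "real \<Rightarrow> nat^'n^'n \<Rightarrow> (nat \<Rightarrow> 'n) measure \<Rightarrow> (((nat \<Rightarrow> 'n) \<times> 'k::metric_space) set \<Rightarrow> real) set" where
  "S_inf \<theta> A m = {\<mu> \<in> AB \<theta> A m. norm_inf \<theta> A m \<mu> < \<infinity> \<and>
     (\<exists>f \<in> lipschitz_functions (shift_metric \<theta> A).
        \<forall>E\<in>sets m. \<mu> (E \<times> UNIV) = (LINT x:E|m. f x))}"

section \<open>Skew products\<close>

definition skew :: "((nat \<Rightarrow> 'n) \<times> 'k \<Rightarrow> 'k) \<Rightarrow> (nat \<Rightarrow> 'n) \<times> 'k \<Rightarrow> (nat \<Rightarrow> 'n) \<times> 'k" where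
  "skew G = (\<lambda>(x, y). (shift x, G (x, y)))"

definition G1 :: "(nat \<Rightarrow> 'n) measure \<Rightarrow> ((nat \<Rightarrow> 'n) \<times> 'k::metric_space \<Rightarrow> 'k) \<Rightarrow> bool" where
  "G1 m G \<longleftrightarrow> (\<exists>\<alpha>. 0 < \<alpha> \<and> \<alpha> < 1 \<and>
     (AE x in m. \<forall>y1 y2. dist (G (x, y1)) (G (x, y2)) \<le> \<alpha> * dist y1 y2))"

definition G2 :: "real \<Rightarrow> nat^'n^'n \<Rightarrow> ((nat \<Rightarrow> 'n) \<times> 'k::metric_space \<Rightarrow> 'k) \<Rightarrow> bool" where
  "G2 \<theta> A G \<longleftrightarrow> (\<exists>k :: 'k \<Rightarrow> real.
     (\<forall>y. k y \<ge> 0 \<and> (\<forall>x1\<in>shift_space A. \<forall>x2\<in>shift_space A.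
        dist (G (x1, y)) (G (x2, y)) \<le> k y * d_theta \<theta> x1 x2)) \<and>
     bdd_above (range k))"

text \<open>The \<open>\<sigma>\<close>-algebra \<open>\<F>\<^sub>0\<close>; \<open>algebra X hull \<G>\<close> is the algebra of subsets of \<open>X\<close> generated by
  \<open>\<G>\<close>.\<close>

definition F0 :: "nat^'n^'n \<Rightarrow> (nat \<Rightarrow> 'n) set set \<Rightarrow> ((nat \<Rightarrow> 'n) \<times> 'k) measure" where
  "F0 A \<G> = sigma (shift_space A \<times> UNIV) ((\<lambda>B. B \<times> UNIV) ` (algebra (shift_space A) hull \<G>))"

end

theory Submission
  imports Defs
begin

text \<open>An \<open>\<F>\<^sub>0\<close>-measurable \<open>\<psi>\<close> is constant on fibers, \<open>\<psi> = f \<circ> fst\<close>, so by invariance of \<open>\<mu>0\<close>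
  the correlation at time \<open>n\<close> is the integral of \<open>f(\<sigma>\<^sup>2\<^sup>n x) \<phi>(F\<^sup>n(x, y))\<close>. The fibers contract and
  \<open>G\<close> is Lipschitz in the base, so \<open>\<phi> \<circ> F\<^sup>n\<close> is exponentially close to a function of the
  coordinates \<open>x\<^sub>0, \<dots>, x\<^sub>L\<close> with \<open>L = n + n div 2\<close>. The gap \<open>2n - L\<close> is at least \<open>n / 2\<close>, and the Markov
  measure \<open>m\<close> decorrelates a function of \<open>x\<^sub>0, \<dots>, x\<^sub>L\<close> from an integrable function of the coordinates
  beyond the gap at an exponential rate. The same mixing property shows that the marginal of \<open>\<mu>0\<close>,
  a shift-invariant measure with Lipschitz density, is \<open>m\<close> itself.\<close>

section \<open>Borel structure of the shift and of the skew product\<close>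

text \<open>Moving the correlation to time 2n is forced by the fiber coordinate: at time 0 the value
  \<phi>(x, y) depends on y, which the letters of x do not determine, whereas after n steps the
  contraction has erased the starting point y up to \<alpha>^n. Letters beyond position n are needed
  as well, since \<open>shift ^^ n\<close> applied to x must itself be known to some precision
  before the Lipschitz bound on \<phi> says anything; half of the remaining n steps pays for this
  precision, the other half for mixing.

  As \<psi> is merely integrable, the mixing estimate has to pair the L^1 norm of f with a sup bound
  on the other factor. It comes from the density of the conditional law given a word,
  \<open>trans_pow P g i j / p $ j\<close>, which tends to 1 uniformly over the finite alphabet. All
  rates come from P, \<alpha> and \<theta>, so \<tau>3 is the same for all \<psi> and \<phi>; these
  enter only through the L^1 norm of f and the sup bound and Lipschitz constant of \<phi>.\<close>

definition cyl :: "nat^'n^'n \<Rightarrow> nat \<Rightarrow> (nat \<Rightarrow> 'n) \<Rightarrow> (nat \<Rightarrow> 'n) set" where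
  "cyl A n w = {x \<in> shift_space A. \<forall>i\<le>n. x i = w i}"

lemma openin_mtopology_of_subset: "openin (mtopology_of X) U \<Longrightarrow> U \<subseteq> mspace X"
  using openin_subset[of "mtopology_of X" U] by simp

lemma space_metric_borel: "space (metric_borel X) = mspace X"
  unfolding metric_borel_def by (rule space_measure_of) (use openin_mtopology_of_subset in blast)

lemma sets_metric_borel: "sets (metric_borel X) = sigma_sets (mspace X) {U. openin (mtopology_of X) U}"
  unfolding metric_borel_def by (rule sets_measure_of) (use openin_mtopology_of_subset in blast)

lemma continuous_map_measurable_metric_borel:
  assumes "continuous_map (mtopology_of X) (mtopology_of Y) f"
  shows "f \<in> measurable (metric_borel X) (metric_borel Y)"
proof -
  have sp: "f \<in> space (metric_borel X) \<rightarrow> mspace Y"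
    using assms by (auto simp: continuous_map_def space_metric_borel)
  show ?thesis
    unfolding metric_borel_def[of Y]
  proof (rule measurable_measure_of[OF _ sp])
    show "{U. openin (mtopology_of Y) U} \<subseteq> Pow (mspace Y)"
      by (use openin_mtopology_of_subset in blast)
    fix U assume "U \<in> {U. openin (mtopology_of Y) U}"
    then have "openin (mtopology_of X) {x \<in> topspace (mtopology_of X). f x \<in> U}"
      using assms by (auto simp: continuous_map_def)
    moreover have "{x \<in> topspace (mtopology_of X). f x \<in> U} = f -` U \<inter> space (metric_borel X)"
      by (auto simp: space_metric_borel)
    ultimately show "f -` U \<inter> space (metric_borel X) \<in> sets (metric_borel X)"
      by (auto simp: sets_metric_borel)
  qed
qed

lemma lipschitz_functions_measurable:
  assumes "f \<in> lipschitz_functions X"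
  shows "f \<in> borel_measurable (metric_borel X)"
proof -
  have "continuous_map (mtopology_of X) (mtopology_of euclidean_metric) f"
    using assms unfolding lipschitz_functions_def mem_Collect_eq
    by (rule Lipschitz_continuous_imp_continuous_map)
  from continuous_map_measurable_metric_borel[OF this]
  show ?thesis
    by (simp add: metric_borel_def borel_def)
qed

text \<open>Words are encoded as total sequences of which only the letters up to n matter, so the
  index set of pairs \<open>(n, w)\<close> is in general uncountable; finite lists index the same
  cylinders.\<close>

lemma countable_cyl: "countable (range (\<lambda>(n, w). cyl (A :: nat^'n^'n::finite) n w))"
proof (rule countable_subset)
  let ?f = "\<lambda>l. {x \<in> shift_space A. \<forall>i<length l. x i = l ! i}"
  show "range (\<lambda>(n, w). cyl A n w) \<subseteq> ?f ` lists UNIV"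
  proof clarify
    fix n and w :: "nat \<Rightarrow> 'n"
    have "cyl A n w = ?f (map w [0..<Suc n])"
      by (auto simp: cyl_def less_Suc_eq_le simp del: upt_Suc)
    then show "cyl A n w \<in> ?f ` lists UNIV" by blast
  qed
  show "countable (?f ` lists UNIV)"
    by (intro countable_image countable_lists countable_finite) simp
qed

lemma shift_in_shift_space: "x \<in> shift_space A \<Longrightarrow> shift x \<in> shift_space A"
  by (auto simp: shift_space_def shift_def)

lemma shift_pow_in_shift_space: "x \<in> shift_space A \<Longrightarrow> (shift ^^ j) x \<in> shift_space A"
  by (induction j) (auto intro: shift_in_shift_space)

lemma shift_pow_apply: "(shift ^^ N) x = (\<lambda>i. x (N + i))"
  by (induction N) (auto simp: shift_def)

section \<open>Cylinders, open sets and Borel sets for the two metrics\<close>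

context
  fixes \<theta> :: real
  assumes theta: "0 < \<theta>" "\<theta> < 1"
begin

lemma d_theta_nonneg: "0 \<le> d_theta \<theta> x y"
  using Metric_space.nonneg[OF Metric_space_d_theta[OF theta, of UNIV]] .

lemma d_theta_agree_le:
  assumes "\<And>i. i < n \<Longrightarrow> x i = y i"
  shows "d_theta \<theta> x y \<le> \<theta> ^ n / (1 - \<theta>)"
proof -
  let ?f = "\<lambda>i. \<theta> ^ i * (1 - (if x i = y i then 1 else 0))"
  have s: "summable ?f" by (rule summable_d_theta[OF theta])
  have "d_theta \<theta> x y = (\<Sum>i. ?f (i + n)) + sum ?f {..<n}"
    unfolding d_theta_def using suminf_split_initial_segment[OF s, of n] by simp
  also have "sum ?f {..<n} = 0" using assms by (intro sum.neutral) auto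
  also have "(\<Sum>i. ?f (i + n)) \<le> (\<Sum>i. \<theta> ^ n * \<theta> ^ i)"
    using theta s by (intro suminf_le summable_mult summable_geometric summable_ignore_initial_segment)
      (auto simp: power_add mult.commute)
  also have "\<dots> = \<theta> ^ n / (1 - \<theta>)"
    using theta by (simp add: suminf_mult summable_geometric suminf_geometric)
  finally show ?thesis by simp
qed

text \<open>A single disagreement at a position \<open>i \<le> n\<close> already costs \<theta>^i,
  which is at least \<theta>^n.\<close>

lemma d_theta_less_imp_agree:
  assumes "d_theta \<theta> x y < \<theta> ^ n" "i \<le> n"
  shows "x i = y i"
proof (rule ccontr)
  assume ne: "x i \<noteq> y i"
  let ?f = "\<lambda>i. \<theta> ^ i * (1 - (if x i = y i then 1 else 0))"
  have "sum ?f {i} \<le> d_theta \<theta> x y"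
    unfolding d_theta_def by (intro sum_le_suminf summable_d_theta theta) (use theta in auto)
  moreover have "\<theta> ^ n \<le> \<theta> ^ i" using theta assms by (intro power_decreasing) auto
  ultimately show False using ne assms(1) by simp
qed

lemma shift_metric_simps [simp]:
  "mspace (shift_metric \<theta> A) = shift_space A"
  "mdist (shift_metric \<theta> A) = d_theta \<theta>"
  unfolding shift_metric_def
  by (simp_all add: Metric_space.mspace_metric[OF Metric_space_d_theta[OF theta]]
      Metric_space.mdist_metric[OF Metric_space_d_theta[OF theta]])

lemma skew_metric_simps [simp]:
  "mspace (skew_metric \<theta> A :: ((nat \<Rightarrow> 'n::finite) \<times> 'k::metric_space) metric) = shift_space A \<times> UNIV"
  "mdist (skew_metric \<theta> A :: ((nat \<Rightarrow> 'n::finite) \<times> 'k::metric_space) metric) = d_sum \<theta>"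
  unfolding skew_metric_def
  by (simp_all add: Metric_space.mspace_metric[OF Metric_space_d_sum[OF theta]]
      Metric_space.mdist_metric[OF Metric_space_d_sum[OF theta]])

text \<open>Cylinders and balls are nested in each other, by the two preceding estimates. The
  resulting description of open sets no longer involves \<theta>.\<close>

lemma openin_shift_metric:
  "openin (mtopology_of (shift_metric \<theta> A)) U \<longleftrightarrow>
     U \<subseteq> shift_space A \<and> (\<forall>x\<in>U. \<exists>n. cyl A n x \<subseteq> U)"
proof -
  interpret Metric_space "shift_space A" "d_theta \<theta>" by (rule Metric_space_d_theta[OF theta])
  have "(\<exists>r>0. mball x r \<subseteq> U) \<longleftrightarrow> (\<exists>n. cyl A n x \<subseteq> U)" if "x \<in> shift_space A" for x
  proof
    assume "\<exists>r>0. mball x r \<subseteq> U"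
    then obtain r where r: "r > 0" "mball x r \<subseteq> U" by blast
    obtain n where n: "\<theta> ^ n < r * (1 - \<theta>)"
      using real_arch_pow_inv[of "r * (1 - \<theta>)" \<theta>] theta r by auto
    have "cyl A n x \<subseteq> mball x r"
    proof
      fix y assume y: "y \<in> cyl A n x"
      have "d_theta \<theta> x y \<le> \<theta> ^ n / (1 - \<theta>)"
        by (rule d_theta_agree_le) (use y in \<open>auto simp: cyl_def\<close>)
      also have "\<dots> < r" using n theta by (simp add: field_simps)
      finally show "y \<in> mball x r" using y that by (auto simp: cyl_def)
    qed
    then show "\<exists>n. cyl A n x \<subseteq> U" using r by blast
  next
    assume "\<exists>n. cyl A n x \<subseteq> U"
    then obtain n where n: "cyl A n x \<subseteq> U" by blast
    have "mball x (\<theta> ^ n) \<subseteq> cyl A n x"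
      using d_theta_less_imp_agree[of x _ n] by (fastforce simp: cyl_def)
    then show "\<exists>r>0. mball x r \<subseteq> U" using n theta by (intro exI[of _ "\<theta> ^ n"]) auto
  qed
  then show ?thesis
    by (auto simp: mtopology_of_def openin_mtopology subset_iff)
qed

lemma openin_skew_metric_rect:
  fixes U :: "((nat \<Rightarrow> 'n::finite) \<times> 'k::metric_space) set"
  assumes "openin (mtopology_of (skew_metric \<theta> A)) U" "(x, y) \<in> U"
  obtains n r where "0 < r" "cyl A n x \<times> ball y r \<subseteq> U"
proof -
  interpret Metric_space "shift_space A \<times> (UNIV::'k set)" "d_sum \<theta>" by (rule Metric_space_d_sum[OF theta])
  obtain r where r: "r > 0" "mball (x, y) r \<subseteq> U"
    using assms unfolding mtopology_of_def openin_mtopology skew_metric_simps by blast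
  have x: "x \<in> shift_space A"
    using assms by (auto simp: mtopology_of_def openin_mtopology)
  obtain n where n: "\<theta> ^ n < r / 2 * (1 - \<theta>)"
    using real_arch_pow_inv[of "r / 2 * (1 - \<theta>)" \<theta>] theta r by auto
  have "cyl A n x \<times> ball y (r / 2) \<subseteq> mball (x, y) r"
  proof clarify
    fix x' y' assume x': "x' \<in> cyl A n x" and y': "y' \<in> ball y (r / 2)"
    have "d_theta \<theta> x x' \<le> \<theta> ^ n / (1 - \<theta>)"
      by (rule d_theta_agree_le) (use x' in \<open>auto simp: cyl_def\<close>)
    also have "\<dots> < r / 2" using n theta by (simp add: field_simps)
    finally show "(x', y') \<in> mball (x, y) r" using x' x y' by (auto simp: cyl_def d_sum_def)
  qed
  with r show ?thesis by (intro that[of "r / 2" n]) auto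
qed

lemma openin_skew_metric_Times:
  fixes A :: "nat^'n^'n::finite"
  assumes "openin (mtopology_of (shift_metric \<theta> A)) U"
  shows "openin (mtopology_of (skew_metric \<theta> A)) (U \<times> (UNIV :: 'k::metric_space set))"
proof -
  interpret Metric_space "shift_space A \<times> (UNIV::'k set)" "d_sum \<theta>" by (rule Metric_space_d_sum[OF theta])
  interpret S: Metric_space "shift_space A" "d_theta \<theta>" by (rule Metric_space_d_theta[OF theta])
  have "\<exists>r>0. mball (x, y) r \<subseteq> U \<times> UNIV" if "x \<in> U" for x and y :: 'k
  proof -
    obtain r where r: "r > 0" "S.mball x r \<subseteq> U"
      using assms \<open>x \<in> U\<close> by (auto simp: mtopology_of_def S.openin_mtopology)
    have "mball (x, y) r \<subseteq> S.mball x r \<times> UNIV"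
    proof (rule subsetI)
      fix q assume q: "q \<in> mball (x, y) r"
      then have "d_theta \<theta> x (fst q) + dist y (snd q) < r" by (auto simp: d_sum_def)
      then have "d_theta \<theta> x (fst q) < r" using zero_le_dist[of y "snd q"] by linarith
      with q show "q \<in> S.mball x r \<times> UNIV" by auto
    qed
    with r show ?thesis by (intro exI[of _ r]) auto
  qed
  then show ?thesis
    using assms by (auto simp: mtopology_of_def openin_mtopology S.openin_mtopology)
qed

lemma openin_cyl: "openin (mtopology_of (shift_metric \<theta> A)) (cyl A n w)"
  unfolding openin_shift_metric by (auto simp: cyl_def intro!: exI[of _ n])

text \<open>An open set is the union of the cylinders inside it, and there are only countably many.
  This makes the cylinders a generator on which measures can be compared.\<close>

lemma sets_shift_borel:
  fixes A :: "nat^'n^'n::finite"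
  shows "sets (metric_borel (shift_metric \<theta> A)) = sigma_sets (shift_space A) (range (\<lambda>(n, w). cyl A n w))"
proof (rule antisym)
  show "sets (metric_borel (shift_metric \<theta> A)) \<subseteq> sigma_sets (shift_space A) (range (\<lambda>(n, w). cyl A n w))"
    unfolding sets_metric_borel shift_metric_simps
  proof (rule sigma_sets_mono, rule subsetI)
    fix U assume "U \<in> {U. openin (mtopology_of (shift_metric \<theta> A)) U}"
    then have U: "U \<subseteq> shift_space A" "\<And>x. x \<in> U \<Longrightarrow> \<exists>n. cyl A n x \<subseteq> U"
      by (auto simp: openin_shift_metric)
    let ?C = "{C \<in> range (\<lambda>(n, w). cyl A n w). C \<subseteq> U}"
    have "U = \<Union> ?C"
    proof (intro equalityI subsetI)
      fix x assume x: "x \<in> U"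
      then obtain n where "cyl A n x \<subseteq> U" using U by blast
      moreover have "x \<in> cyl A n x" using x U by (auto simp: cyl_def)
      ultimately show "x \<in> \<Union> ?C" by (intro UnionI[of "cyl A n x"]) auto
    qed auto
    moreover have "\<Union> ?C \<in> sigma_sets (shift_space A) (range (\<lambda>(n, w). cyl A n w))"
      by (rule sigma_sets_UNION) (auto intro: countable_subset[OF _ countable_cyl])
    ultimately show "U \<in> sigma_sets (shift_space A) (range (\<lambda>(n, w). cyl A n w))" by simp
  qed
  show "sigma_sets (shift_space A) (range (\<lambda>(n, w). cyl A n w)) \<subseteq> sets (metric_borel (shift_metric \<theta> A))"
    unfolding sets_metric_borel shift_metric_simps
    by (rule sigma_sets_mono') (auto simp: openin_cyl)
qed

lemma measurable_fst_skew_borel: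
  fixes A :: "nat^'n^'n::finite"
  shows "fst \<in> measurable (skew_borel \<theta> A :: ((nat \<Rightarrow> 'n) \<times> 'k::metric_space) measure)
    (metric_borel (shift_metric \<theta> A))"
proof (rule continuous_map_measurable_metric_borel)
  show "continuous_map (mtopology_of (skew_metric \<theta> A :: ((nat \<Rightarrow> 'n) \<times> 'k) metric))
     (mtopology_of (shift_metric \<theta> A)) fst"
    unfolding continuous_map_def
  proof (intro conjI allI impI)
    fix U assume U: "openin (mtopology_of (shift_metric \<theta> A)) U"
    moreover have "{p \<in> topspace (mtopology_of (skew_metric \<theta> A :: ((nat \<Rightarrow> 'n) \<times> 'k) metric)). fst p \<in> U} = U \<times> UNIV"
      using openin_mtopology_of_subset[OF U] by auto
    ultimately show "openin (mtopology_of (skew_metric \<theta> A)) {p \<in> topspace (mtopology_of (skew_metric \<theta> A :: ((nat \<Rightarrow> 'n) \<times> 'k) metric)). fst p \<in> U}"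
      by (simp only: openin_skew_metric_Times)
  qed auto
qed

text \<open>Compactness of the fiber is what makes the Borel \<open>\<sigma>\<close>-algebra of the product no larger than
  the product of the Borel \<open>\<sigma>\<close>-algebras.\<close>

lemma sets_skew_borel_subset:
  fixes A :: "nat^'n^'n::finite"
  assumes "compact (UNIV :: 'k::metric_space set)"
  shows "sets (skew_borel \<theta> A) \<subseteq> sets (metric_borel (shift_metric \<theta> A) \<Otimes>\<^sub>M (borel :: 'k measure))"
proof -
  let ?PM = "metric_borel (shift_metric \<theta> A) \<Otimes>\<^sub>M (borel :: 'k measure)"
  have "\<exists>F. finite F \<and> (UNIV :: 'k set) \<subseteq> (\<Union>x\<in>F. ball x (1 / Suc k))" for k
    using compact_eq_totally_bounded[of "UNIV :: 'k set"] assms by (auto simp: )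
  then obtain F where F: "\<And>k. finite (F k)" "\<And>k. (UNIV :: 'k set) \<subseteq> (\<Union>x\<in>F k. ball x (1 / Suc k))"
    by metis
  \<comment> \<open>Cylinders times balls around the points of finite 1/(k+1)-nets: total
    boundedness makes this a countable family of rectangles, which still serves as a base.\<close>
  define R where "R = (\<lambda>(C, k, q). C \<times> ball q (1 / Suc k)) ` (range (\<lambda>(n, w). cyl A n w) \<times> (SIGMA k:UNIV. F k))"
  have cR: "countable R"
    unfolding R_def by (intro countable_image countable_SIGMA countable_cyl) (auto intro: countable_finite F)
  have R: "C \<in> sets ?PM" if "C \<in> R" for C
    using that unfolding R_def by (auto simp: sets_metric_borel openin_cyl intro!: pair_measureI)
  have "sigma_sets (shift_space A \<times> UNIV) {U. openin (mtopology_of (skew_metric \<theta> A)) U} \<subseteq> sets ?PM"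
  proof (rule sets.sigma_sets_subset'[of _ ?PM, simplified space_pair_measure space_metric_borel shift_metric_simps space_borel])
    show "{U. openin (mtopology_of (skew_metric \<theta> A)) U} \<subseteq> sets ?PM"
    proof clarify
      fix U :: "((nat \<Rightarrow> 'n) \<times> 'k) set" assume U: "openin (mtopology_of (skew_metric \<theta> A)) U"
      have "U = \<Union> {C \<in> R. C \<subseteq> U}"
      proof (intro equalityI subsetI)
        fix p assume p: "p \<in> U"
        obtain x y where xy: "p = (x, y)" by (cases p)
        obtain n r where nr: "0 < r" "cyl A n x \<times> ball y r \<subseteq> U"
          using openin_skew_metric_rect[OF U] p xy by blast
        \<comment> \<open>Half of r, because the ball will be centred at the net point q and not at
          y.\<close>
        obtain k where k: "1 / Suc k < r / 2" using nr by (meson half_gt_zero nat_approx_posE)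
        obtain q where q: "q \<in> F k" "y \<in> ball q (1 / Suc k)" using F(2)[of k] by blast
        have "ball q (1 / Suc k) \<subseteq> ball y r"
        proof
          fix z assume "z \<in> ball q (1 / Suc k)"
          then have "dist y z < r" using q k dist_triangle3[of y z q] by auto
          then show "z \<in> ball y r" by simp
        qed
        then have "cyl A n x \<times> ball q (1 / Suc k) \<subseteq> U" using nr by blast
        moreover have "cyl A n x \<times> ball q (1 / Suc k) \<in> R"
          unfolding R_def using q by (intro image_eqI[of _ _ "(cyl A n x, k, q)"]) auto
        moreover have "x \<in> cyl A n x" using openin_mtopology_of_subset[OF U] p xy by (auto simp: cyl_def)
        ultimately show "p \<in> \<Union> {C \<in> R. C \<subseteq> U}" using q xy by blast
      qed auto
      also have "\<dots> \<in> sets ?PM"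
        by (rule sets.countable_Union) (auto intro: countable_subset[OF _ cR] R)
      finally show "U \<in> sets ?PM" .
    qed
    show "shift_space A \<times> UNIV \<in> sets ?PM"
      using sets.top[of ?PM] by (simp add: space_pair_measure space_metric_borel)
  qed
  then show ?thesis by (simp add: sets_metric_borel)
qed

lemma measurable_shift:
  fixes A :: "nat^'n^'n::finite"
  shows "shift \<in> measurable (metric_borel (shift_metric \<theta> A)) (metric_borel (shift_metric \<theta> A))"
proof (rule continuous_map_measurable_metric_borel)
  show "continuous_map (mtopology_of (shift_metric \<theta> A)) (mtopology_of (shift_metric \<theta> A)) shift"
    unfolding continuous_map_def
  proof (intro conjI allI impI)
    fix U assume "openin (mtopology_of (shift_metric \<theta> A)) U"
    then have U: "U \<subseteq> shift_space A" "\<And>x. x \<in> U \<Longrightarrow> \<exists>n. cyl A n x \<subseteq> U"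
      by (auto simp: openin_shift_metric)
    have "\<exists>n. cyl A n x \<subseteq> {x \<in> shift_space A. shift x \<in> U}" if x: "x \<in> shift_space A" "shift x \<in> U" for x
    proof -
      obtain n where n: "cyl A n (shift x) \<subseteq> U" using U(2)[OF x(2)] by blast
      have "shift y \<in> cyl A n (shift x)" if "y \<in> cyl A (Suc n) x" for y
        using that shift_in_shift_space[of y] by (auto simp: cyl_def shift_def)
      then have "cyl A (Suc n) x \<subseteq> {x \<in> shift_space A. shift x \<in> U}"
        using n by (auto simp: cyl_def)
      then show ?thesis by blast
    qed
    then show "openin (mtopology_of (shift_metric \<theta> A))
        {x \<in> topspace (mtopology_of (shift_metric \<theta> A)). shift x \<in> U}"
      by (auto simp: openin_shift_metric)
  qed (auto intro: shift_in_shift_space)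
qed

text \<open>Pairing two measurable maps gives measurability only into the product \<sigma>-algebra;
  the inclusion proved above, hence compactness of K, brings it down to the Borel
  \<sigma>-algebra.\<close>

lemma measurable_skew:
  fixes A :: "nat^'n^'n::finite" and G :: "(nat \<Rightarrow> 'n) \<times> 'k::metric_space \<Rightarrow> 'k"
  assumes K: "compact (UNIV :: 'k set)" and G: "G \<in> measurable (skew_borel \<theta> A) borel"
  shows "skew G \<in> measurable (skew_borel \<theta> A) (skew_borel \<theta> A)"
proof -
  let ?PM = "metric_borel (shift_metric \<theta> A) \<Otimes>\<^sub>M (borel :: 'k measure)"
  have "(\<lambda>p. (shift (fst p), G p)) \<in> measurable (skew_borel \<theta> A) ?PM"
    by (intro measurable_Pair G measurable_compose[OF measurable_fst_skew_borel measurable_shift])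
  moreover have "(\<lambda>p. (shift (fst p), G p)) = skew G"
    by (auto simp: skew_def)
  moreover have "measurable (skew_borel \<theta> A) ?PM \<subseteq> measurable (skew_borel \<theta> A) (skew_borel \<theta> A)"
    by (rule measurable_mono) (auto simp: sets_skew_borel_subset[OF K] space_metric_borel space_pair_measure)
  ultimately show ?thesis by auto
qed

end

section \<open>Mixing of Markov measures\<close>

text \<open>The entries of the g-th power of P. The recursion splits off the first transition, which
  matches the refinement of a cylinder by one more letter.\<close>

primrec trans_pow :: "real^'n^'n \<Rightarrow> nat \<Rightarrow> 'n::finite \<Rightarrow> 'n \<Rightarrow> real" where
  "trans_pow P 0 i j = (if i = j then 1 else 0)"
| "trans_pow P (Suc g) i j = (\<Sum>l\<in>UNIV. P $ i $ l * trans_pow P g l j)"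

lemma trans_pow_add:
  "trans_pow P (k + g) i j = (\<Sum>l\<in>UNIV. trans_pow P k i l * trans_pow P g l j)"
proof (induction k arbitrary: i)
  case 0
  show ?case by (simp add: if_distrib[of "\<lambda>a. a * _"] cong: if_cong)
next
  case (Suc k)
  have "trans_pow P (Suc k + g) i j
      = (\<Sum>l'\<in>UNIV. \<Sum>l\<in>UNIV. P $ i $ l' * (trans_pow P k l' l * trans_pow P g l j))"
    by (simp add: Suc sum_distrib_left)
  also have "\<dots> = (\<Sum>l\<in>UNIV. \<Sum>l'\<in>UNIV. P $ i $ l' * (trans_pow P k l' l * trans_pow P g l j))"
    by (rule sum.swap)
  finally show ?case by (simp add: sum_distrib_right mult.assoc)
qed

lemma trans_pow_nonneg: "(\<And>i j. 0 \<le> P $ i $ j) \<Longrightarrow> 0 \<le> trans_pow P g i j"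
  by (induction g arbitrary: i) (auto intro!: sum_nonneg)

text \<open>Only supports matter: a positive entry of a power of A comes from an admissible path,
  and P is positive on each of its transitions. This carries aperiodicity from A to P.\<close>

lemma trans_pow_pos:
  assumes P: "\<And>i j. 0 \<le> P $ i $ j" "\<And>i j. A $ i $ j > 0 \<Longrightarrow> P $ i $ j > 0"
    and "matpow A k $ i $ j > 0"
  shows "trans_pow P k i j > 0"
  using assms(3)
proof (induction k arbitrary: i)
  case 0
  then show ?case by (simp add: matpow_def mat_def split: if_splits)
next
  case (Suc k)
  have "(\<Sum>l\<in>UNIV. A $ i $ l * matpow A k $ l $ j) > 0"
    using Suc.prems by (simp add: matpow_def matrix_matrix_mult_def)
  then obtain l where "A $ i $ l * matpow A k $ l $ j \<noteq> 0"
    by (metis (no_types, lifting) less_numeral_extra(3) sum.neutral)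
  then have "P $ i $ l * trans_pow P k l j > 0"
    using Suc.IH[of l] P(2)[of i l] by simp
  then show ?case
    using P(1) by (auto intro!: sum_pos2[of _ l] mult_nonneg_nonneg trans_pow_nonneg)
qed

lemma trans_pow_row_sum:
  assumes "\<And>i. (\<Sum>j\<in>UNIV. P $ i $ j) = 1"
  shows "(\<Sum>j\<in>UNIV. trans_pow P g i j) = 1"
proof (induction g arbitrary: i)
  case (Suc g)
  have "(\<Sum>j\<in>UNIV. trans_pow P (Suc g) i j) = (\<Sum>l\<in>UNIV. \<Sum>j\<in>UNIV. P $ i $ l * trans_pow P g l j)"
    unfolding trans_pow.simps by (rule sum.swap)
  then show ?case by (simp add: sum_distrib_left[symmetric] Suc assms)
qed simp

lemma trans_pow_stationary:
  assumes "\<And>j. (\<Sum>i\<in>UNIV. p $ i * P $ i $ j) = p $ j"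
  shows "(\<Sum>i\<in>UNIV. p $ i * trans_pow P g i j) = p $ j"
proof (induction g)
  case 0
  show ?case by (simp add: if_distrib[of "\<lambda>a. _ * a"] cong: if_cong)
next
  case (Suc g)
  have "(\<Sum>i\<in>UNIV. p $ i * trans_pow P (Suc g) i j)
      = (\<Sum>i\<in>UNIV. \<Sum>l\<in>UNIV. p $ i * P $ i $ l * trans_pow P g l j)"
    by (simp add: sum_distrib_left mult.assoc)
  also have "\<dots> = (\<Sum>l\<in>UNIV. \<Sum>i\<in>UNIV. p $ i * P $ i $ l * trans_pow P g l j)"
    by (rule sum.swap)
  finally show ?case by (simp add: sum_distrib_right[symmetric] assms Suc)
qed

text \<open>Doeblin's minorization \<open>P\<^sup>k \<ge> c p\<close> makes \<open>P\<^sup>k - c p\<close> a nonnegative matrix with row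
  sums \<open>1 - c\<close>; as \<open>P\<^sup>g - p\<close> is annihilated by \<open>p\<close>, each factor \<open>P\<^sup>k\<close> contracts it by \<open>1 - c\<close>.\<close>

lemma trans_pow_convergence:
  fixes P :: "real^'n^'n::finite" and p :: "real^'n"
  assumes P: "\<And>i j. 0 \<le> P $ i $ j" "\<And>i. (\<Sum>j\<in>UNIV. P $ i $ j) = 1"
    and p: "\<And>i. 0 \<le> p $ i" "(\<Sum>i\<in>UNIV. p $ i) = 1"
      "\<And>j. (\<Sum>i\<in>UNIV. p $ i * P $ i $ j) = p $ j"
    and k: "\<And>i j. trans_pow P k i j > 0"
  obtains r C where "0 < r" "r < 1" "\<And>j. p $ j > 0"
    "\<And>g i j. \<bar>trans_pow P g i j / p $ j - 1\<bar> \<le> C * r ^ (g div k)"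
proof -
  define e where "e = Min (range (\<lambda>(i, j). trans_pow P k i j))"
  have e: "0 < e" "\<And>i j. e \<le> trans_pow P k i j"
  proof -
    have "e \<in> range (\<lambda>(i, j). trans_pow P k i j)" unfolding e_def by (intro Min_in) auto
    then show "0 < e" using k by auto
    show "e \<le> trans_pow P k i j" for i j unfolding e_def by (intro Min_le) auto
  qed
  \<comment> \<open>The cap 1/2 keeps the rate \<open>1 - c\<close> strictly positive: for a
    one-letter alphabet e equals 1.\<close>
  define c where "c = min e (1 / 2)"
  have c: "0 < c" "c < 1" using e by (auto simp: c_def)
  have p_le: "p $ j \<le> 1" for j
    using member_le_sum[of j UNIV "\<lambda>i. p $ i"] p by simp
  \<comment> \<open>Stationarity makes \<open>p $ j\<close> a p-average of the entries of column j
    of the k-th power, all of them at least e.\<close>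
  have p_pos: "p $ j > 0" for j
  proof -
    have "e = (\<Sum>i\<in>UNIV. p $ i * e)" using p by (simp add: sum_distrib_right[symmetric])
    also have "\<dots> \<le> (\<Sum>i\<in>UNIV. p $ i * trans_pow P k i j)"
      by (intro sum_mono mult_left_mono e p)
    also have "\<dots> = p $ j" by (rule trans_pow_stationary[OF p(3)])
    finally show ?thesis using e by simp
  qed
  have minor: "c * p $ j \<le> trans_pow P k i j" for i j
    using mult_mono[of c e "p $ j" 1] e(2)[of i j] c p_le[of j] p(1)[of j] e(1) by (auto simp: c_def)
  have step: "\<bar>trans_pow P (k + g) i j - p $ j\<bar> \<le> (1 - c) * b"
    if b: "\<And>l. \<bar>trans_pow P g l j - p $ j\<bar> \<le> b" for g i j b
  proof -
    let ?v = "\<lambda>l. trans_pow P g l j - p $ j"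
    have pv: "(\<Sum>l\<in>UNIV. p $ l * ?v l) = 0"
      by (simp add: right_diff_distrib sum_subtractf trans_pow_stationary[OF p(3)]
          sum_distrib_right[symmetric] p)
    have "trans_pow P (k + g) i j - p $ j = (\<Sum>l\<in>UNIV. trans_pow P k i l * ?v l)"
      by (simp add: trans_pow_add right_diff_distrib sum_subtractf
          sum_distrib_right[symmetric] trans_pow_row_sum[OF P(2)])
    also have "\<dots> = (\<Sum>l\<in>UNIV. (trans_pow P k i l - c * p $ l) * ?v l) + c * (\<Sum>l\<in>UNIV. p $ l * ?v l)"
      by (simp add: sum_distrib_left sum.distrib[symmetric] algebra_simps)
    finally have "\<bar>trans_pow P (k + g) i j - p $ j\<bar>
        \<le> (\<Sum>l\<in>UNIV. \<bar>(trans_pow P k i l - c * p $ l) * ?v l\<bar>)"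
      using pv by simp
    also have "\<dots> \<le> (\<Sum>l\<in>UNIV. (trans_pow P k i l - c * p $ l) * b)"
      using minor b by (intro sum_mono) (auto simp: abs_mult intro!: mult_mono)
    also have "\<dots> = (1 - c) * b"
      by (simp add: sum_distrib_right[symmetric] sum_subtractf trans_pow_row_sum[OF P(2)]
          sum_distrib_left[symmetric] p)
    finally show ?thesis .
  qed
  have entry_le: "trans_pow P g i j \<le> 1" for g i j
    using member_le_sum[of j UNIV "trans_pow P g i"] trans_pow_nonneg[OF P(1)]
      trans_pow_row_sum[OF P(2), of g i] by simp
  have base: "\<bar>trans_pow P g i j - p $ j\<bar> \<le> 1" for g i j
    using entry_le[of g i j] trans_pow_nonneg[OF P(1), of g i j] p_le[of j] p(1)[of j] by simp
  \<comment> \<open>Only full blocks of k steps contract; the s leftover steps are covered by the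
    trivial bound 1. Hence the exponent \<open>g div k\<close>.\<close>
  have iter: "\<bar>trans_pow P (k * q + s) i j - p $ j\<bar> \<le> (1 - c) ^ q" for q s i j
  proof (induction q arbitrary: i)
    case (Suc q)
    have "\<bar>trans_pow P (k + (k * q + s)) i j - p $ j\<bar> \<le> (1 - c) * (1 - c) ^ q"
      by (rule step) (rule Suc)
    then show ?case by (simp add: add.assoc)
  qed (simp add: base)
  \<comment> \<open>The error is wanted relative to \<open>p $ j\<close>, so the smallest weight
    determines the constant C.\<close>
  define e' where "e' = Min (range (\<lambda>j. p $ j))"
  have e': "0 < e'" "\<And>j. e' \<le> p $ j"
  proof -
    have "e' \<in> range (\<lambda>j. p $ j)" unfolding e'_def by (intro Min_in) auto
    then show "0 < e'" using p_pos by auto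
    show "e' \<le> p $ j" for j unfolding e'_def by (intro Min_le) auto
  qed
  show ?thesis
  proof (rule that[of "1 - c" "1 / e'"])
    fix g i j
    have "trans_pow P g i j / p $ j - 1 = (trans_pow P g i j - p $ j) / p $ j"
      using p_pos[of j] by (simp add: field_simps)
    then have "\<bar>trans_pow P g i j / p $ j - 1\<bar> = \<bar>trans_pow P g i j - p $ j\<bar> / p $ j"
      using p_pos[of j] by simp
    also have "\<dots> \<le> (1 - c) ^ (g div k) / e'"
      using iter[of "g div k" "g mod k" i j] e' c by (intro frac_le) auto
    finally show "\<bar>trans_pow P g i j / p $ j - 1\<bar> \<le> 1 / e' * (1 - c) ^ (g div k)" by simp
  qed (use c p_pos in auto)
qed

lemma distr_funpow:
  assumes T: "T \<in> measurable M M" "distr M M T = M"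
  shows "distr M M (T ^^ N) = M"
proof (induction N)
  case 0
  show ?case by (simp add: distr_id id_def)
next
  case (Suc N)
  have "T ^^ N \<in> measurable M M" by (rule measurable_compose_n[OF T(1)])
  then show ?case
    using distr_distr[OF T(1), of "T ^^ N" M] Suc T(2) by (simp add: comp_def)
qed

section \<open>Stationary Markov measures on the shift space\<close>

locale stationary_chain = prob_space m
  for m :: "(nat \<Rightarrow> 'n::finite) measure" +
  fixes \<theta> :: real and A :: "nat^'n^'n" and P :: "real^'n^'n" and p :: "real^'n"
  assumes theta: "0 < \<theta>" "\<theta> < 1"
    and sets_m: "sets m = sets (metric_borel (shift_metric \<theta> A))"
    and measure_cyl: "\<And>n w. measure m (cyl A n w) = p $ w 0 * (\<Prod>i<n. P $ w i $ w (Suc i))"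
    and distr_shift: "distr m m shift = m"
begin

lemma space_m: "space m = shift_space A"
  using sets_eq_imp_space_eq[OF sets_m] theta by (simp add: space_metric_borel)

lemma cyl_sets [measurable]: "cyl A n w \<in> sets m"
  using openin_cyl[OF theta] by (auto simp: sets_m sets_metric_borel)

lemma shift_measurable [measurable]: "shift \<in> measurable m m"
  using measurable_shift[OF theta, of A] measurable_cong_sets[OF sets_m sets_m] by blast

lemma shift_pow_measurable [measurable]: "(shift ^^ N) \<in> measurable m m"
  by (induction N) (auto intro: measurable_comp)

lemma distr_shift_pow: "distr m m (shift ^^ N) = m"
  by (rule distr_funpow[OF shift_measurable distr_shift])

text \<open>Stationarity of the initial distribution is not part of the data. It follows from shift
  invariance on a one-letter cylinder, whose preimage splits into the two-letter cylinders ending in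
  j.\<close>

lemma stationary: "(\<Sum>i\<in>UNIV. p $ i * P $ i $ j) = p $ j"
proof -
  let ?C = "\<lambda>i. cyl A 1 (\<lambda>n. if n = 0 then i else j)"
  have "p $ j = measure (distr m m shift) (cyl A 0 (\<lambda>_. j))"
    using measure_cyl[of 0 "\<lambda>_. j"] by (simp add: distr_shift)
  also have "\<dots> = measure m (shift -` cyl A 0 (\<lambda>_. j) \<inter> space m)"
    by (rule measure_distr) measurable
  also have "shift -` cyl A 0 (\<lambda>_. j) \<inter> space m = (\<Union>i\<in>UNIV. ?C i)"
  proof (intro equalityI subsetI)
    fix x assume "x \<in> shift -` cyl A 0 (\<lambda>_. j) \<inter> space m"
    then have "x \<in> ?C (x 0)" by (auto simp: cyl_def space_m shift_def le_Suc_eq)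
    then show "x \<in> (\<Union>i\<in>UNIV. ?C i)" by blast
  next
    fix x assume "x \<in> (\<Union>i\<in>UNIV. ?C i)"
    then show "x \<in> shift -` cyl A 0 (\<lambda>_. j) \<inter> space m"
      using shift_in_shift_space[of x A] by (auto simp: cyl_def space_m shift_def)
  qed
  also have "measure m (\<Union>i\<in>UNIV. ?C i) = (\<Sum>i\<in>UNIV. measure m (?C i))"
  proof (rule finite_measure_finite_Union)
    show "disjoint_family_on ?C UNIV"
      by (auto simp: disjoint_family_on_def cyl_def)
  qed auto
  also have "\<dots> = (\<Sum>i\<in>UNIV. p $ i * P $ i $ j)"
    by (simp add: measure_cyl)
  finally show ?thesis by simp
qed

end

text \<open>A separate locale, because positivity of p is itself deduced from stationarity and the
  positivity of a power of P; from here on one divides by \<open>p $ i\<close>.\<close>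

locale positive_chain = stationary_chain m \<theta> A P p
  for m :: "(nat \<Rightarrow> 'n::finite) measure" and \<theta> A P p +
  assumes p_pos: "\<And>i. p $ i > 0"
begin

lemma coord_measurable: "(\<lambda>x. c (x 0)) \<in> borel_measurable m"
proof -
  have "(\<lambda>x. x 0) \<in> measurable m (count_space (UNIV :: 'n set))"
  proof (subst measurable_count_space_eq2_countable)
    show "(\<lambda>x. x 0) \<in> space m \<rightarrow> UNIV \<and> (\<forall>a\<in>UNIV. (\<lambda>x. x 0) -` {a} \<inter> space m \<in> sets m)"
    proof (intro conjI ballI)
      fix a
      have "(\<lambda>x. x 0) -` {a} \<inter> space m = cyl A 0 (\<lambda>_. a)"
        by (auto simp: cyl_def space_m)
      then show "(\<lambda>x. x 0) -` {a} \<inter> space m \<in> sets m" by simp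
    qed auto
  qed
  then show ?thesis by measurable
qed

lemma integrable_coord_mult:
  assumes "integrable m f"
  shows "integrable m (\<lambda>x. c (x 0) * f x :: real)"
proof (rule Bochner_Integration.integrable_bound)
  show "integrable m (\<lambda>x. Max (range (\<lambda>j. \<bar>c j\<bar>)) * f x)" using assms by simp
  show "(\<lambda>x. c (x 0) * f x) \<in> borel_measurable m"
    using assms by (intro borel_measurable_times coord_measurable) auto
  have "\<bar>c (x 0)\<bar> \<le> \<bar>Max (range (\<lambda>j. \<bar>c j\<bar>))\<bar>" for x
    by (rule order_trans[OF Max_ge abs_ge_self]) auto
  then show "AE x in m. norm (c (x 0) * f x) \<le> norm (Max (range (\<lambda>j. \<bar>c j\<bar>)) * f x)"
    unfolding real_norm_def abs_mult by (intro always_eventually allI mult_right_mono) auto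
qed

lemma integrable_shift_pow:
  "integrable m f \<Longrightarrow> integrable m (\<lambda>x. f ((shift ^^ N) x) :: real)"
  using integrable_distr[OF shift_pow_measurable, of N f] by (simp add: distr_shift_pow)

lemma integrable_indicator_shift_pow:
  "integrable m f \<Longrightarrow> integrable m (\<lambda>x. indicator (cyl A n w) x * f ((shift ^^ N) x) :: real)"
  using integrable_mult_indicator[OF cyl_sets integrable_shift_pow] by simp

lemma measure_cyl_Suc:
  "measure m (cyl A (Suc n) (w(Suc n := s))) = measure m (cyl A n w) * P $ w n $ s"
  unfolding measure_cyl by (simp add: prod.lessThan_Suc)

text \<open>The two words overlap in the letter at position n. If it matches, they glue to one word
  of the chain, in which the initial weight \<open>p $ v 0\<close> of the second word must not be
  counted again; this explains the quotient.\<close>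

lemma measure_cyl_shift_cyl:
  "measure m (cyl A n w \<inter> ((shift ^^ n) -` cyl A k v \<inter> space m)) =
     (if w n = v 0 then measure m (cyl A n w) / p $ v 0 * measure m (cyl A k v) else 0)"
proof (cases "w n = v 0")
  case True
  let ?u = "\<lambda>i. if i \<le> n then w i else v (i - n)"
  have u: "?u (n + i) = v i" for i using True by (cases i) auto
  have "cyl A n w \<inter> ((shift ^^ n) -` cyl A k v \<inter> space m) = cyl A (n + k) ?u"
  proof (intro equalityI subsetI)
    fix x assume x: "x \<in> cyl A n w \<inter> ((shift ^^ n) -` cyl A k v \<inter> space m)"
    have "x i = ?u i" if "i \<le> n + k" for i
    proof (cases "i \<le> n")
      case False
      then have "(shift ^^ n) x (i - n) = v (i - n)" using x that by (auto simp: cyl_def)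
      then show ?thesis using False by (simp add: shift_pow_apply)
    qed (use x in \<open>auto simp: cyl_def\<close>)
    then show "x \<in> cyl A (n + k) ?u" using x by (auto simp: cyl_def)
  next
    fix x assume x: "x \<in> cyl A (n + k) ?u"
    then have xm: "x \<in> space m" by (simp add: cyl_def space_m)
    have xu: "x i = ?u i" if "i \<le> n + k" for i using x that by (auto simp: cyl_def)
    have "(shift ^^ n) x i = v i" if "i \<le> k" for i
      using xu[of "n + i"] that u[of i] by (simp add: shift_pow_apply)
    moreover have "x i = w i" if "i \<le> n" for i
      using xu[of i] that by simp
    moreover have "(shift ^^ n) x \<in> shift_space A"
      using measurable_space[OF shift_pow_measurable xm] by (simp add: space_m)
    ultimately show "x \<in> cyl A n w \<inter> ((shift ^^ n) -` cyl A k v \<inter> space m)"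
      using xm by (auto simp: cyl_def space_m)
  qed
  moreover have "(\<Prod>i<n + k. f i) = (\<Prod>i<n. f i) * (\<Prod>i<k. f (n + i))" for f :: "nat \<Rightarrow> real"
    by (induction k) (auto simp: mult.assoc)
  ultimately have "measure m (cyl A n w \<inter> ((shift ^^ n) -` cyl A k v \<inter> space m)) =
      p $ ?u 0 * ((\<Prod>i<n. P $ ?u i $ ?u (Suc i)) * (\<Prod>i<k. P $ ?u (n + i) $ ?u (n + Suc i)))"
    by (simp only: measure_cyl add_Suc_right)
  also have "(\<Prod>i<n. P $ ?u i $ ?u (Suc i)) = (\<Prod>i<n. P $ w i $ w (Suc i))"
    by (intro prod.cong) auto
  also have "(\<Prod>i<k. P $ ?u (n + i) $ ?u (n + Suc i)) = (\<Prod>i<k. P $ v i $ v (Suc i))"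
    by (simp only: u)
  finally show ?thesis using True p_pos[of "v 0"] by (simp add: measure_cyl)
next
  case False
  then have "cyl A n w \<inter> ((shift ^^ n) -` cyl A k v \<inter> space m) = {}"
    by (auto simp: cyl_def shift_pow_apply)
  then show ?thesis using False by simp
qed

text \<open>The Markov property as an identity of measures: after restriction to a word, the law of
  the future from its last letter on is m with a density in the first coordinate only. Both sides
  agree on cylinders by the preceding formula. \<open>trans_pow P 0\<close> is the Kronecker delta,
  written so that this is the case of gap 0 in the induction that follows.\<close>

lemma density_cyl:
  "distr (density m (indicator (cyl A n w))) m (shift ^^ n) =
     density m (\<lambda>x. ennreal (measure m (cyl A n w) * (trans_pow P 0 (w n) (x 0) / p $ (x 0))))"
  (is "?M = density m (\<lambda>x. ennreal (?c (x 0)))")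
proof (rule measure_eqI_generator_eq)
  \<comment> \<open>Two cylinders may be disjoint, so the empty set is added to make the family
    closed under intersection.\<close>
  let ?E = "insert {} (range (\<lambda>(n, w). cyl A n w))"
  have c_meas: "(\<lambda>x. ennreal (?c (x 0))) \<in> borel_measurable m"
    using coord_measurable[of ?c] by (rule measurable_compose[OF _ measurable_ennreal])
  show "Int_stable ?E"
  proof (rule Int_stableI)
    have *: "cyl A a v \<inter> cyl A b u \<in> ?E" if "a \<le> b" for a b and v u :: "nat \<Rightarrow> 'n"
    proof (cases "\<forall>i\<le>a. v i = u i")
      case True
      then have "cyl A b u \<subseteq> cyl A a v" using that unfolding cyl_def by force
      then have "cyl A a v \<inter> cyl A b u = (\<lambda>(n, w). cyl A n w) (b, u)" by auto
      then show ?thesis by blast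
    next
      case False
      then obtain i where i: "i \<le> a" "v i \<noteq> u i" by blast
      then have "x \<notin> cyl A a v \<inter> cyl A b u" for x using that by (auto simp: cyl_def)
      then show ?thesis by blast
    qed
    fix S T assume "S \<in> ?E" "T \<in> ?E"
    then consider "S \<inter> T = {}" | a v b u where "S = cyl A a v" "T = cyl A b u" by auto
    then show "S \<inter> T \<in> ?E"
    proof cases
      case 2
      show ?thesis
        using *[of a b v u] *[of b a u v] linear[of a b] unfolding 2 Int_commute[of "cyl A b u"] by blast
    qed simp
  qed
  show "?E \<subseteq> Pow (shift_space A)" by (auto simp: cyl_def)
  have "sigma_sets (shift_space A) ?E = sigma_sets (shift_space A) (range (\<lambda>(n, w). cyl A n w))"
    by (intro antisym sigma_sets_mono insert_subsetI sigma_sets.Empty sigma_sets_superset_generator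
        subset_trans[OF subset_insertI sigma_sets_superset_generator])
  then have sm: "sets m = sigma_sets (shift_space A) ?E"
    using sets_shift_borel[OF theta, of A] sets_m by simp
  show "sets ?M = sigma_sets (shift_space A) ?E"
    "sets (density m (\<lambda>x. ennreal (?c (x 0)))) = sigma_sets (shift_space A) ?E"
    using sm by simp_all
  \<comment> \<open>A cover by sets of finite measure. The enumeration of the finite alphabet
    repeats letters, which is harmless because the cover need not be disjoint.\<close>
  let ?A = "\<lambda>i. cyl A 0 (\<lambda>_. from_nat_into UNIV i)"
  show "range ?A \<subseteq> ?E" by auto
  have "x \<in> (\<Union>i. ?A i)" if "x \<in> shift_space A" for x
  proof -
    obtain i where "from_nat_into UNIV i = x 0"
      using from_nat_into_surj[of "UNIV :: 'n set" "x 0"] countable_finite[of "UNIV :: 'n set"] by auto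
    then have "x \<in> ?A i" using that by (simp add: cyl_def)
    then show ?thesis by (rule UN_I[OF UNIV_I])
  qed
  then show "(\<Union>i. ?A i) = shift_space A" by (auto simp: cyl_def)
  have val: "emeasure ?M S = emeasure m (cyl A n w \<inter> ((shift ^^ n) -` S \<inter> space m))" if "S \<in> sets m" for S
  proof -
    have pre: "(shift ^^ n) -` S \<inter> space m \<in> sets m"
      using measurable_sets[OF shift_pow_measurable that] .
    then show ?thesis
      using that by (simp add: emeasure_distr emeasure_restricted)
  qed
  show "emeasure ?M (?A i) \<noteq> \<infinity>" for i
    by (simp add: val emeasure_eq_measure)
  fix S assume "S \<in> ?E"
  then consider "S = {}" | k v where "S = cyl A k v" by auto
  then show "emeasure ?M S = emeasure (density m (\<lambda>x. ennreal (?c (x 0)))) S"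
  proof cases
    case 2
    have "emeasure (density m (\<lambda>x. ennreal (?c (x 0)))) S = (\<integral>\<^sup>+x. ennreal (?c (v 0)) * indicator S x \<partial>m)"
      unfolding 2 emeasure_density[OF c_meas cyl_sets]
    proof (rule nn_integral_cong)
      fix x
      have "x 0 = v 0" if "x \<in> cyl A k v" using that by (simp add: cyl_def)
      then show "ennreal (?c (x 0)) * indicator (cyl A k v) x = ennreal (?c (v 0)) * indicator (cyl A k v) x"
        by (cases "x \<in> cyl A k v") simp_all
    qed
    also have "\<dots> = ennreal (?c (v 0) * measure m S)"
      unfolding 2 using p_pos[of "v 0"]
      by (simp only: nn_integral_cmult_indicator cyl_sets emeasure_eq_measure) (simp add: ennreal_mult[symmetric])
    finally have "emeasure (density m (\<lambda>x. ennreal (?c (x 0)))) S = ennreal (?c (v 0) * measure m S)" .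
    moreover have "emeasure ?M S = ennreal (?c (v 0) * measure m S)"
      using val[of S] measure_cyl_shift_cyl[of n w k v] unfolding 2 emeasure_eq_measure by simp
    ultimately show ?thesis by simp
  qed simp
qed

text \<open>Induction on the gap: splitting the cylinder by its next letter lengthens the word by
  one and shortens the gap by one, and summing over that letter reproduces the recursion of
  \<open>trans_pow\<close>. Starting from an identity of measures allows every integrable f, bounded
  or not.\<close>

lemma integral_cyl_shift_pow:
  fixes f :: "(nat \<Rightarrow> 'n) \<Rightarrow> real"
  assumes f: "integrable m f"
  shows "(\<integral>x. indicator (cyl A n w) x * f ((shift ^^ (n + g)) x) \<partial>m) =
    measure m (cyl A n w) * (\<integral>x. trans_pow P g (w n) (x 0) / p $ (x 0) * f x \<partial>m)"
proof (induction g arbitrary: n w)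
  case 0
  let ?c = "\<lambda>j. measure m (cyl A n w) * (trans_pow P 0 (w n) j / p $ j)"
  note [measurable] = coord_measurable[of ?c]
  have [measurable]: "f \<in> borel_measurable m" using f by auto
  have nn: "0 \<le> ?c j" for j using p_pos[of j] by simp
  have "(\<integral>x. indicator (cyl A n w) x * f ((shift ^^ (n + 0)) x) \<partial>m) =
      (\<integral>x. f ((shift ^^ n) x) \<partial>density m (\<lambda>x. ennreal (indicator (cyl A n w) x)))"
    by (subst integral_density) auto
  also have "\<dots> = (\<integral>x. f x \<partial>distr (density m (indicator (cyl A n w))) m (shift ^^ n))"
    by (subst integral_distr) (simp_all add: ennreal_indicator)
  also have "\<dots> = (\<integral>x. ?c (x 0) * f x \<partial>m)"
    unfolding density_cyl using coord_measurable[of ?c]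
    by (subst integral_density) (auto simp only: nn real_scaleR_def \<open>f \<in> borel_measurable m\<close> intro!: always_eventually)
  also have "\<dots> = measure m (cyl A n w) * (\<integral>x. trans_pow P 0 (w n) (x 0) / p $ (x 0) * f x \<partial>m)"
    by (subst integral_mult_right_zero[symmetric]) (simp only: mult.assoc)
  finally show ?case .
next
  case (Suc g)
  let ?w = "\<lambda>s. w(Suc n := s)"
  have split: "indicator (cyl A n w) x = (\<Sum>s\<in>UNIV. indicator (cyl A (Suc n) (?w s)) x :: real)" for x
  proof -
    have "(indicator (cyl A (Suc n) (?w s)) x :: real) = (if s = x (Suc n) then indicator (cyl A n w) x else 0)" for s
      by (auto simp: cyl_def le_Suc_eq split: split_indicator)
    then show ?thesis by simp
  qed
  have "(\<integral>x. indicator (cyl A n w) x * f ((shift ^^ (n + Suc g)) x) \<partial>m)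
      = (\<Sum>s\<in>UNIV. \<integral>x. indicator (cyl A (Suc n) (?w s)) x * f ((shift ^^ (Suc n + g)) x) \<partial>m)"
    unfolding split sum_distrib_right add_Suc_right add_Suc
    by (intro Bochner_Integration.integral_sum integrable_indicator_shift_pow f)
  also have "\<dots> = (\<Sum>s\<in>UNIV. measure m (cyl A n w) *
      (\<integral>x. P $ w n $ s * (trans_pow P g s (x 0) / p $ (x 0) * f x) \<partial>m))"
    unfolding Suc.IH measure_cyl_Suc integral_mult_right_zero by (simp add: mult.assoc)
  also have "\<dots> = measure m (cyl A n w) *
      (\<integral>x. (\<Sum>s\<in>UNIV. P $ w n $ s * (trans_pow P g s (x 0) / p $ (x 0) * f x)) \<partial>m)"
    unfolding sum_distrib_left[symmetric]
    by (subst Bochner_Integration.integral_sum) (rule integrable_mult_right integrable_coord_mult f refl)+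
  also have "(\<lambda>x. \<Sum>s\<in>UNIV. P $ w n $ s * (trans_pow P g s (x 0) / p $ (x 0) * f x))
      = (\<lambda>x. trans_pow P (Suc g) (w n) (x 0) / p $ (x 0) * f x)"
    by (simp add: sum_distrib_right sum_divide_distrib mult.assoc)
  finally show ?case .
qed

text \<open>Words are taken here as extensional functions, so that there are finitely many and x
  meets the cylinder of exactly one of them.\<close>

lemma word_sum:
  assumes "x \<in> shift_space A"
  shows "H (restrict x {..n}) = (\<Sum>w\<in>PiE {..n} (\<lambda>_. UNIV). H w * indicator (cyl A n w) x :: real)"
proof -
  have "(\<Sum>w\<in>PiE {..n} (\<lambda>_. UNIV). H w * indicator (cyl A n w) x)
      = (\<Sum>w\<in>PiE {..n} (\<lambda>_. UNIV). if w = restrict x {..n} then H w else 0)"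
  proof (intro sum.cong refl)
    fix w :: "nat \<Rightarrow> 'n" assume w: "w \<in> PiE {..n} (\<lambda>_. UNIV)"
    then have "x \<in> cyl A n w \<longleftrightarrow> w = restrict x {..n}"
      using assms by (auto simp: cyl_def fun_eq_iff PiE_def extensional_def restrict_def)
    then show "H w * indicator (cyl A n w) x = (if w = restrict x {..n} then H w else 0)"
      by auto
  qed
  also have "\<dots> = H (restrict x {..n})"
    by (simp add: finite_PiE)
  finally show ?thesis by simp
qed

lemma word_measurable: "(\<lambda>x. H (restrict x {..n}) :: real) \<in> borel_measurable m"
proof -
  have "(\<lambda>x. \<Sum>w\<in>PiE {..n} (\<lambda>_. UNIV). H w * indicator (cyl A n w) x :: real) \<in> borel_measurable m"
    by measurable
  then show ?thesis
    by (subst measurable_cong[OF word_sum[of _ H n]]) (auto simp: space_m)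
qed

text \<open>Given the word w on \<open>{..n}\<close>, the integral of the shifted f is that of f
  against the density \<open>trans_pow P g (w n) (x 0) / p $ (x 0)\<close>. As this is within
  \<delta> of 1, each word costs at most \<delta> times the L^1 norm of f, and the cylinder measures
  sum to 1.\<close>

lemma mixing_word:
  fixes f :: "(nat \<Rightarrow> 'n) \<Rightarrow> real"
  assumes f: "integrable m f" and H: "\<And>w. \<bar>H w\<bar> \<le> B"
    and \<delta>: "\<And>i j. \<bar>trans_pow P g i j / p $ j - 1\<bar> \<le> \<delta>"
  shows "\<bar>(\<integral>x. f ((shift ^^ (n + g)) x) * H (restrict x {..n}) \<partial>m)
      - (\<integral>x. f x \<partial>m) * (\<integral>x. H (restrict x {..n}) \<partial>m)\<bar> \<le> B * \<delta> * (\<integral>x. \<bar>f x\<bar> \<partial>m)"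
proof -
  let ?W = "PiE {..n} (\<lambda>_. UNIV :: 'n set)"
  let ?q = "\<lambda>w x. trans_pow P g (w n) (x 0) / p $ (x 0)"
  have finW: "finite ?W" by (simp add: finite_PiE)
  have B: "0 \<le> B" using order_trans[OF abs_ge_zero H] .
  have "(\<integral>x. f ((shift ^^ (n + g)) x) * H (restrict x {..n}) \<partial>m)
      = (\<integral>x. (\<Sum>w\<in>?W. H w * (indicator (cyl A n w) x * f ((shift ^^ (n + g)) x))) \<partial>m)"
    by (intro Bochner_Integration.integral_cong refl)
      (simp add: space_m word_sum sum_distrib_left mult_ac)
  also have "\<dots> = (\<Sum>w\<in>?W. H w * measure m (cyl A n w) * (\<integral>x. ?q w x * f x \<partial>m))"
    by (subst Bochner_Integration.integral_sum)
      (auto intro: integrable_indicator_shift_pow f simp: integral_cyl_shift_pow[OF f] mult.assoc)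
  finally have 1: "(\<integral>x. f ((shift ^^ (n + g)) x) * H (restrict x {..n}) \<partial>m)
      = (\<Sum>w\<in>?W. H w * measure m (cyl A n w) * (\<integral>x. ?q w x * f x \<partial>m))" .
  have integral_word: "(\<integral>x. H' (restrict x {..n}) \<partial>m) = (\<Sum>w\<in>?W. H' w * measure m (cyl A n w))"
    for H' :: "(nat \<Rightarrow> 'n) \<Rightarrow> real"
  proof -
    have "(\<integral>x. H' (restrict x {..n}) \<partial>m) = (\<integral>x. (\<Sum>w\<in>?W. H' w * indicator (cyl A n w) x) \<partial>m)"
      by (intro Bochner_Integration.integral_cong refl) (simp add: space_m word_sum)
    also have "\<dots> = (\<Sum>w\<in>?W. H' w * measure m (cyl A n w))"
      using integrable_real_indicator[OF cyl_sets] emeasure_finite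
      by (subst Bochner_Integration.integral_sum) (auto simp: less_top[symmetric])
    finally show ?thesis .
  qed
  have "(\<integral>x. f ((shift ^^ (n + g)) x) * H (restrict x {..n}) \<partial>m)
      - (\<integral>x. f x \<partial>m) * (\<integral>x. H (restrict x {..n}) \<partial>m)
      = (\<Sum>w\<in>?W. H w * measure m (cyl A n w) * ((\<integral>x. ?q w x * f x \<partial>m) - (\<integral>x. f x \<partial>m)))"
    unfolding 1 integral_word by (simp add: right_diff_distrib sum_subtractf sum_distrib_left mult_ac)
  also have "\<bar>\<dots>\<bar> \<le> (\<Sum>w\<in>?W. B * measure m (cyl A n w) * (\<delta> * (\<integral>x. \<bar>f x\<bar> \<partial>m)))"
  proof (rule order_trans[OF sum_abs], rule sum_mono)
    fix w
    have "(\<integral>x. ?q w x * f x \<partial>m) - (\<integral>x. f x \<partial>m) = (\<integral>x. (?q w x - 1) * f x \<partial>m)"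
      using integrable_coord_mult[OF f, of "\<lambda>j. trans_pow P g (w n) j / p $ j"] f
      by (simp add: left_diff_distrib)
    also have "\<bar>\<dots>\<bar> \<le> (\<integral>x. \<delta> * \<bar>f x\<bar> \<partial>m)"
    proof (rule order_trans[OF integral_abs_bound integral_mono])
      show "integrable m (\<lambda>x. \<bar>(?q w x - 1) * f x\<bar>)"
        using integrable_coord_mult[OF f, of "\<lambda>j. trans_pow P g (w n) j / p $ j - 1"] by simp
      show "\<bar>(?q w x - 1) * f x\<bar> \<le> \<delta> * \<bar>f x\<bar>" for x
        using \<delta> by (simp add: abs_mult mult_right_mono)
    qed (use f in auto)
    finally have "\<bar>(\<integral>x. ?q w x * f x \<partial>m) - (\<integral>x. f x \<partial>m)\<bar> \<le> \<delta> * (\<integral>x. \<bar>f x\<bar> \<partial>m)" by simp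
    then show "\<bar>H w * measure m (cyl A n w) * ((\<integral>x. ?q w x * f x \<partial>m) - (\<integral>x. f x \<partial>m))\<bar>
        \<le> B * measure m (cyl A n w) * (\<delta> * (\<integral>x. \<bar>f x\<bar> \<partial>m))"
      unfolding abs_mult using H B by (intro mult_mono) auto
  qed
  also have "\<dots> = B * (\<Sum>w\<in>?W. measure m (cyl A n w)) * (\<delta> * (\<integral>x. \<bar>f x\<bar> \<partial>m))"
    by (simp only: sum_distrib_left sum_distrib_right)
  also have "(\<Sum>w\<in>?W. measure m (cyl A n w)) = 1"
    using integral_word[of "\<lambda>_. 1"] by (simp add: prob_space)
  finally show ?thesis by (simp only: mult.assoc mult_1 mult_1_right)
qed

text \<open>Here U need not factor through \<pi>; it only has to be close to a function of a word.
  Replacing U costs \<epsilon> in the correlation and \<epsilon> in the product of means, hence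
  \<open>2 * \<epsilon>\<close>. The lemma serves twice, with \<pi> the identity of the shift space
  and with \<pi> the projection of the skew product.\<close>

lemma mixing_approx:
  fixes f :: "(nat \<Rightarrow> 'n) \<Rightarrow> real" and U :: "'b \<Rightarrow> real"
  assumes M: "prob_space M" "\<pi> \<in> measurable M m" "distr M m \<pi> = m"
    and f: "integrable m f" and H: "\<And>w. \<bar>H w\<bar> \<le> B"
    and \<delta>: "\<And>i j. \<bar>trans_pow P g i j / p $ j - 1\<bar> \<le> \<delta>"
    and U: "U \<in> borel_measurable M" "AE q in M. \<bar>U q - H (restrict (\<pi> q) {..n})\<bar> \<le> \<epsilon>"
  shows "\<bar>(\<integral>q. f ((shift ^^ (n + g)) (\<pi> q)) * U q \<partial>M) - (\<integral>x. f x \<partial>m) * (\<integral>q. U q \<partial>M)\<bar>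
    \<le> (2 * \<epsilon> + B * \<delta>) * (\<integral>x. \<bar>f x\<bar> \<partial>m)"
proof -
  interpret M: prob_space M by fact
  note [measurable] = M(2) U(1)
  have fm [measurable]: "f \<in> borel_measurable m" using f by auto
  define V where "V = (\<lambda>q. f ((shift ^^ (n + g)) (\<pi> q)))"
  define h where "h = (\<lambda>q. H (restrict (\<pi> q) {..n}))"
  note [measurable] = word_measurable[of H n]
  have V_meas [measurable]: "V \<in> borel_measurable M" unfolding V_def by measurable
  have h_meas [measurable]: "h \<in> borel_measurable M"
    unfolding h_def by (rule measurable_compose[OF M(2) word_measurable])
  have pull: "(\<integral>q. F (\<pi> q) \<partial>M) = (\<integral>x. F x \<partial>m)" if "F \<in> borel_measurable m" for F :: "(nat \<Rightarrow> 'n) \<Rightarrow> real"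
    using integral_distr[OF M(2) that] M(3) by simp
  have intV: "integrable M V"
    using integrable_distr[OF M(2), of "\<lambda>x. f ((shift ^^ (n + g)) x)"] integrable_shift_pow[OF f] M(3)
    by (simp add: V_def)
  have absV: "(\<integral>q. \<bar>V q\<bar> \<partial>M) = (\<integral>x. \<bar>f x\<bar> \<partial>m)"
  proof -
    have "(\<integral>q. \<bar>V q\<bar> \<partial>M) = (\<integral>x. \<bar>f ((shift ^^ (n + g)) x)\<bar> \<partial>m)"
      unfolding V_def by (rule pull) measurable
    also have "\<dots> = (\<integral>x. \<bar>f x\<bar> \<partial>distr m m (shift ^^ (n + g)))"
      by (subst integral_distr) auto
    finally show ?thesis by (simp add: distr_shift_pow)
  qed
  have hB: "\<bar>h q\<bar> \<le> B" for q unfolding h_def by (rule H)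
  have inth: "integrable M h"
    by (rule M.integrable_const_bound[of _ B]) (use hB in auto)
  \<comment> \<open>V is only integrable, so the product with U needs an essential bound on U; it is
    inherited from the approximating h.\<close>
  have UB: "AE q in M. \<bar>U q\<bar> \<le> B + \<epsilon>"
    using U(2)
  proof eventually_elim
    case (elim q)
    then show ?case using hB[of q] unfolding h_def by linarith
  qed
  have intU: "integrable M U"
    by (rule M.integrable_const_bound[of _ "B + \<epsilon>"]) (use UB in auto)
  have intVU: "integrable M (\<lambda>q. V q * U q)"
  proof (rule Bochner_Integration.integrable_bound[of _ "\<lambda>q. (B + \<epsilon>) * V q"])
    show "AE q in M. norm (V q * U q) \<le> norm ((B + \<epsilon>) * V q)"
      using UB
    proof eventually_elim
      case (elim q)
      then have "\<bar>U q\<bar> \<le> \<bar>B + \<epsilon>\<bar>" by linarith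
      then show ?case unfolding real_norm_def abs_mult
        by (subst mult.commute) (rule mult_right_mono, auto)
    qed
  qed (use intV in auto)
  have intVh: "integrable M (\<lambda>q. V q * h q)"
  proof (rule Bochner_Integration.integrable_bound[of _ "\<lambda>q. B * V q"])
    have "\<bar>h q\<bar> \<le> \<bar>B\<bar>" for q using hB[of q] by linarith
    then show "AE q in M. norm (V q * h q) \<le> norm (B * V q)"
      unfolding real_norm_def abs_mult mult.commute[of "\<bar>V _\<bar>"]
      by (intro always_eventually allI mult_right_mono) auto
  qed (use intV in auto)
  have eps: "AE q in M. \<bar>U q - h q\<bar> \<le> \<epsilon>" using U(2) by (simp add: h_def)
  have "\<bar>(\<integral>q. V q * U q \<partial>M) - (\<integral>q. V q * h q \<partial>M)\<bar> = \<bar>\<integral>q. V q * (U q - h q) \<partial>M\<bar>"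
    using intVU intVh by (simp add: right_diff_distrib)
  also have "\<dots> \<le> (\<integral>q. \<bar>V q * (U q - h q)\<bar> \<partial>M)"
    by (rule integral_abs_bound)
  also have "\<dots> \<le> (\<integral>q. \<epsilon> * \<bar>V q\<bar> \<partial>M)"
  proof (rule integral_mono_AE)
    show "integrable M (\<lambda>q. \<bar>V q * (U q - h q)\<bar>)"
      using intVU intVh by (simp add: right_diff_distrib)
    show "AE q in M. \<bar>V q * (U q - h q)\<bar> \<le> \<epsilon> * \<bar>V q\<bar>"
      using eps
    proof eventually_elim
      case (elim q)
      then show ?case unfolding abs_mult by (subst mult.commute) (rule mult_right_mono, auto)
    qed
  qed (use intV in auto)
  finally have a: "\<bar>(\<integral>q. V q * U q \<partial>M) - (\<integral>q. V q * h q \<partial>M)\<bar> \<le> \<epsilon> * (\<integral>x. \<bar>f x\<bar> \<partial>m)"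
    by (simp add: absV)
  have "\<bar>(\<integral>q. h q \<partial>M) - (\<integral>q. U q \<partial>M)\<bar> = \<bar>\<integral>q. U q - h q \<partial>M\<bar>"
    using inth intU by simp
  also have "\<dots> \<le> (\<integral>q. \<bar>U q - h q\<bar> \<partial>M)"
    by (rule integral_abs_bound)
  also have "\<dots> \<le> (\<integral>q. \<epsilon> \<partial>M)"
    using eps inth intU by (intro integral_mono_AE) auto
  finally have "\<bar>(\<integral>q. h q \<partial>M) - (\<integral>q. U q \<partial>M)\<bar> \<le> \<epsilon>"
    by (simp add: M.prob_space)
  moreover have "\<bar>\<integral>x. f x \<partial>m\<bar> \<le> (\<integral>x. \<bar>f x\<bar> \<partial>m)"
    by (rule integral_abs_bound)
  ultimately have "\<bar>(\<integral>x. f x \<partial>m) * ((\<integral>q. h q \<partial>M) - (\<integral>q. U q \<partial>M))\<bar> \<le> (\<integral>x. \<bar>f x\<bar> \<partial>m) * \<epsilon>"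
    unfolding abs_mult by (intro mult_mono) auto
  then have b: "\<bar>(\<integral>x. f x \<partial>m) * (\<integral>q. h q \<partial>M) - (\<integral>x. f x \<partial>m) * (\<integral>q. U q \<partial>M)\<bar> \<le> \<epsilon> * (\<integral>x. \<bar>f x\<bar> \<partial>m)"
    by (simp add: right_diff_distrib mult.commute)
  have "(\<integral>q. V q * h q \<partial>M) = (\<integral>x. f ((shift ^^ (n + g)) x) * H (restrict x {..n}) \<partial>m)"
    unfolding V_def h_def by (rule pull) measurable
  moreover have "(\<integral>q. h q \<partial>M) = (\<integral>x. H (restrict x {..n}) \<partial>m)"
    unfolding h_def by (rule pull) measurable
  ultimately have "\<bar>(\<integral>q. V q * h q \<partial>M) - (\<integral>x. f x \<partial>m) * (\<integral>q. h q \<partial>M)\<bar> \<le> B * \<delta> * (\<integral>x. \<bar>f x\<bar> \<partial>m)"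
    using mixing_word[OF f H \<delta>, of n] by simp
  with a b show ?thesis unfolding V_def by (simp add: algebra_simps)
qed

end

section \<open>Approximation by functions of finitely many coordinates\<close>

lemma cyl_restrict: "cyl A n (restrict x {..n}) = cyl A n x"
  by (auto simp: cyl_def)

text \<open>u is sampled at an arbitrary point of the cylinder. The value 0 on inadmissible words
  keeps bounds on u valid for all words, since a choice from an empty cylinder could fall outside
  the shift space.\<close>

definition word_value :: "nat^'n^'n \<Rightarrow> nat \<Rightarrow> ((nat \<Rightarrow> 'n::finite) \<Rightarrow> real) \<Rightarrow> (nat \<Rightarrow> 'n) \<Rightarrow> real" where
  "word_value A n u w = (if cyl A n w = {} then 0 else u (SOME x. x \<in> cyl A n w))"

lemma word_value_bound:
  assumes "\<And>x. x \<in> shift_space A \<Longrightarrow> \<bar>u x\<bar> \<le> B" "0 \<le> B"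
  shows "\<bar>word_value A n u w\<bar> \<le> B"
proof (cases "cyl A n w = {}")
  case False
  then have "(SOME x. x \<in> cyl A n w) \<in> cyl A n w" by (simp add: some_in_eq)
  then show ?thesis using assms False by (simp add: word_value_def cyl_def)
qed (simp add: word_value_def assms)

lemma word_value_restrict:
  assumes "x \<in> shift_space A"
  obtains x' where "x' \<in> shift_space A" "\<And>i. i \<le> n \<Longrightarrow> x i = x' i"
    "word_value A n u (restrict x {..n}) = u x'"
proof -
  let ?x = "SOME x'. x' \<in> cyl A n x"
  have ne: "x \<in> cyl A n x" using assms by (simp add: cyl_def)
  then have "?x \<in> cyl A n x" by (rule someI[of "\<lambda>x'. x' \<in> cyl A n x"])
  moreover have "word_value A n u (restrict x {..n}) = u ?x"
    using ne by (auto simp: word_value_def cyl_restrict)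
  ultimately show ?thesis by (intro that[of ?x]) (auto simp: cyl_def)
qed

lemma lipschitz_functionsE:
  assumes "f \<in> lipschitz_functions X"
  obtains L where "0 < L" "\<And>x y. x \<in> mspace X \<Longrightarrow> y \<in> mspace X \<Longrightarrow> \<bar>f x - f y\<bar> \<le> L * mdist X x y"
  using assms unfolding lipschitz_functions_def mem_Collect_eq Lipschitz_continuous_map_pos
  by (auto simp: dist_real_def)

lemma bounded_lipschitz_function:
  assumes "f \<in> lipschitz_functions X" "\<And>x y. x \<in> mspace X \<Longrightarrow> y \<in> mspace X \<Longrightarrow> mdist X x y \<le> d"
  obtains B where "0 \<le> B" "\<And>x. x \<in> mspace X \<Longrightarrow> \<bar>f x\<bar> \<le> B"
proof (cases "mspace X = {}")
  case True
  then show ?thesis by (intro that[of 0]) auto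
next
  case False
  then obtain z where z: "z \<in> mspace X" by blast
  obtain L where L: "0 < L" "\<And>x y. x \<in> mspace X \<Longrightarrow> y \<in> mspace X \<Longrightarrow> \<bar>f x - f y\<bar> \<le> L * mdist X x y"
    using lipschitz_functionsE[OF assms(1)] by blast
  have d: "0 \<le> d" using assms(2)[OF z z] mdist_nonneg[of X z z] by linarith
  show ?thesis
  proof (rule that[of "\<bar>f z\<bar> + L * d"])
    fix x assume x: "x \<in> mspace X"
    have "L * mdist X x z \<le> L * d" using assms(2)[OF x z] L(1) by simp
    then show "\<bar>f x\<bar> \<le> \<bar>f z\<bar> + L * d" using L(2)[OF x z] by linarith
  qed (use d L in auto)
qed

text \<open>Mixing forces an invariant law with Lipschitz density f to have density 1: the law of E
  is the correlation of f with the indicator of E at every time N, and this converges to the product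
  of the integral of f, which is 1, with the m-measure of E.\<close>

lemma (in positive_chain) marginal_unique:
  fixes M :: "'b measure"
  assumes M: "prob_space M" "\<pi> \<in> measurable M m" "T \<in> measurable M M" "distr M M T = M"
    and semi: "\<And>q. q \<in> space M \<Longrightarrow> \<pi> (T q) = shift (\<pi> q)"
    and f: "f \<in> lipschitz_functions (shift_metric \<theta> A)"
      "\<And>E. E \<in> sets m \<Longrightarrow> measure M (\<pi> -` E \<inter> space M) = (LINT x:E|m. f x)"
    and \<delta>: "\<And>g i j. \<bar>trans_pow P g i j / p $ j - 1\<bar> \<le> \<delta> g" "\<delta> \<longlonglongrightarrow> 0"
  shows "distr M m \<pi> = m"
proof -
  interpret M: prob_space M by fact
  interpret D: prob_space "distr M m \<pi>" by (rule M.prob_space_distr[OF M(2)])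
  obtain L where L: "0 < L" "\<And>x y. x \<in> shift_space A \<Longrightarrow> y \<in> shift_space A \<Longrightarrow> \<bar>f x - f y\<bar> \<le> L * d_theta \<theta> x y"
    using lipschitz_functionsE[OF f(1)] theta by (metis shift_metric_simps)
  have d1: "d_theta \<theta> x y \<le> 1 / (1 - \<theta>)" for x y :: "nat \<Rightarrow> 'n"
    using d_theta_agree_le[OF theta, of 0 x y] by simp
  obtain B where B: "0 \<le> B" "\<And>x. x \<in> shift_space A \<Longrightarrow> \<bar>f x\<bar> \<le> B"
    using bounded_lipschitz_function[OF f(1), of "1 / (1 - \<theta>)"] d1 theta by (metis shift_metric_simps)
  have [measurable]: "f \<in> borel_measurable m"
    using lipschitz_functions_measurable[OF f(1)] measurable_cong_sets[OF sets_m refl] by blast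
  have Tpow: "(T ^^ N) q \<in> space M \<and> \<pi> ((T ^^ N) q) = (shift ^^ N) (\<pi> q)" if "q \<in> space M" for N q
    using that by (induction N) (auto simp: semi measurable_space[OF M(3)])
  have total: "(\<integral>x. f x \<partial>m) = 1"
  proof -
    have "1 = measure M (\<pi> -` space m \<inter> space M)"
      using measurable_space[OF M(2)] by (subst M.prob_space[symmetric]) (rule arg_cong[of _ _ "measure M"], auto)
    also have "\<dots> = (LINT x:space m|m. f x)" by (rule f(2)) simp
    also have "\<dots> = (\<integral>x. f x \<partial>m)" by (simp add: set_lebesgue_integral_def cong: Bochner_Integration.integral_cong)
    finally show ?thesis by simp
  qed
  have eq: "measure M (\<pi> -` E \<inter> space M) = measure m E" if E: "E \<in> sets m" for E
  proof -
    \<comment> \<open>The left side is free of N: invariance under the N-th iterate of T replaces E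
      by its preimage under \<open>shift ^^ N\<close>.\<close>
    have invar: "measure M (\<pi> -` E \<inter> space M) = (\<integral>x. indicator E ((shift ^^ N) x) * f x \<partial>m)" for N
    proof -
      have pE: "\<pi> -` E \<inter> space M \<in> sets M" using measurable_sets[OF M(2) E] .
      have TN: "T ^^ N \<in> measurable M M" by (rule measurable_compose_n[OF M(3)])
      have "measure M (\<pi> -` E \<inter> space M) = measure (distr M M (T ^^ N)) (\<pi> -` E \<inter> space M)"
        by (simp add: distr_funpow[OF M(3,4)])
      also have "\<dots> = measure M ((T ^^ N) -` (\<pi> -` E \<inter> space M) \<inter> space M)"
        by (rule measure_distr[OF TN pE])
      also have "(T ^^ N) -` (\<pi> -` E \<inter> space M) \<inter> space M = \<pi> -` ((shift ^^ N) -` E \<inter> space m) \<inter> space M"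
        using Tpow measurable_space[OF M(2)] by auto
      also have "measure M \<dots> = (LINT x:(shift ^^ N) -` E \<inter> space m|m. f x)"
        by (rule f(2)) (rule measurable_sets[OF shift_pow_measurable E])
      also have "\<dots> = (\<integral>x. indicator E ((shift ^^ N) x) * f x \<partial>m)"
        unfolding set_lebesgue_integral_def
        by (intro Bochner_Integration.integral_cong) (auto split: split_indicator)
      finally show ?thesis .
    qed
    have bound: "\<bar>measure M (\<pi> -` E \<inter> space M) - measure m E\<bar>
        \<le> (2 * (L * (\<theta> ^ n / (1 - \<theta>))) + B * \<delta> n) * measure m E" for n
    proof -
      have "\<bar>f x - word_value A n f (restrict (id x) {..n})\<bar> \<le> L * (\<theta> ^ n / (1 - \<theta>))"
        if x: "x \<in> space m" for x
      proof -
        obtain x' where x': "x' \<in> shift_space A" "\<And>i. i \<le> n \<Longrightarrow> x i = x' i"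
          "word_value A n f (restrict x {..n}) = f x'"
          using x word_value_restrict[of x A n f] by (auto simp: space_m)
        have "\<bar>f x - f x'\<bar> \<le> L * d_theta \<theta> x x'" using L(2) x x' by (simp add: space_m)
        also have "\<dots> \<le> L * (\<theta> ^ n / (1 - \<theta>))"
          using L(1) x'(2) by (intro mult_left_mono d_theta_agree_le theta) auto
        finally show ?thesis using x'(3) by simp
      qed
      \<comment> \<open>The roles are exchanged: the indicator of E is the integrable factor and the
        density f the one approximated by words. Of the 2n steps, n fix the precision and n form the
        gap.\<close>
      then have "\<bar>(\<integral>x. indicator E ((shift ^^ (n + n)) (id x)) * f x \<partial>m)
          - (\<integral>x. indicator E x \<partial>m) * (\<integral>x. f x \<partial>m)\<bar>
          \<le> (2 * (L * (\<theta> ^ n / (1 - \<theta>))) + B * \<delta> n) * (\<integral>x. \<bar>indicator E x\<bar> \<partial>m)"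
        using E by (intro mixing_approx[where H = "word_value A n f"] prob_space_axioms \<delta>(1) word_value_bound B)
          (auto simp: distr_id2 id_def emeasure_eq_measure)
      then show ?thesis using E total by (simp add: invar[of "n + n"])
    qed
    have "(\<lambda>n. (2 * (L * (\<theta> ^ n / (1 - \<theta>))) + B * \<delta> n) * measure m E) \<longlonglongrightarrow> (2 * (L * (0 / (1 - \<theta>))) + B * 0) * measure m E"
      using theta by (intro tendsto_intros \<delta>(2) LIMSEQ_realpow_zero) auto
    then have "\<bar>measure M (\<pi> -` E \<inter> space M) - measure m E\<bar> \<le> (2 * (L * (0 / (1 - \<theta>))) + B * 0) * measure m E"
      using bound by (intro LIMSEQ_le_const) auto
    then show ?thesis by simp
  qed
  show ?thesis
  proof (rule measure_eqI)
    fix E assume "E \<in> sets (distr M m \<pi>)"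
    then have E: "E \<in> sets m" by simp
    then have "measure (distr M m \<pi>) E = measure m E"
      using eq measure_distr[OF M(2) E] by simp
    then show "emeasure (distr M m \<pi>) E = emeasure m E"
      by (simp add: emeasure_eq_measure D.emeasure_eq_measure)
  qed simp
qed

section \<open>Contraction along the fibers\<close>

lemma skew_apply: "skew G q = (shift (fst q), G q)"
  by (cases q) (simp add: skew_def)

lemma skew_pow_fst: "fst ((skew G ^^ j) q) = (shift ^^ j) (fst q)"
  by (induction j) (auto simp: skew_apply)

lemma skew_pow_snd_Suc: "snd ((skew G ^^ Suc j) q) = G ((shift ^^ j) (fst q), snd ((skew G ^^ j) q))"
  by (subst skew_pow_fst[symmetric, where G = G]) (simp add: skew_apply)

lemma d_theta_shift_pow_le:
  assumes "0 < \<theta>" "\<theta> < 1" "\<And>i. i \<le> n \<Longrightarrow> x i = x' i" "j \<le> n"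
  shows "d_theta \<theta> ((shift ^^ j) x) ((shift ^^ j) x') \<le> \<theta> ^ (n - j) / (1 - \<theta>)"
  by (rule d_theta_agree_le) (use assms in \<open>auto simp: shift_pow_apply\<close>)

text \<open>The contraction is only needed along the orbit of one of the two base points, which is why an
  almost everywhere hypothesis suffices.\<close>

lemma fiber_dist_le:
  fixes G :: "(nat \<Rightarrow> 'n::finite) \<times> 'k::metric_space \<Rightarrow> 'k"
  assumes theta: "0 < \<theta>" "\<theta> < 1" and \<alpha>: "0 \<le> \<alpha>" "\<alpha> \<le> 1" and \<kappa>: "0 \<le> \<kappa>"
    and diam: "\<And>y1 y2 :: 'k. dist y1 y2 \<le> 1"
    and x: "x \<in> shift_space A" "x' \<in> shift_space A"
    and contr: "\<And>j y1 y2. dist (G ((shift ^^ j) x, y1)) (G ((shift ^^ j) x, y2)) \<le> \<alpha> * dist y1 y2"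
    and lip: "\<And>y x1 x2. x1 \<in> shift_space A \<Longrightarrow> x2 \<in> shift_space A \<Longrightarrow>
      dist (G (x1, y)) (G (x2, y)) \<le> \<kappa> * d_theta \<theta> x1 x2"
    and agree: "\<And>i. i \<le> n \<Longrightarrow> x i = x' i" and "j \<le> n"
  shows "dist (snd ((skew G ^^ j) (x, y))) (snd ((skew G ^^ j) (x', y')))
    \<le> \<alpha> ^ j + \<kappa> / (1 - \<theta>)\<^sup>2 * \<theta> ^ (n - j)"
  using \<open>j \<le> n\<close>
proof (induction j)
  case 0
  have "0 \<le> \<kappa> / (1 - \<theta>)\<^sup>2 * \<theta> ^ (n - 0)" using theta \<kappa> by simp
  then show ?case using diam[of y y'] by simp
next
  case (Suc j)
  \<comment> \<open>With error weights \<open>\<theta> ^ (n - j)\<close>, one step closes the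
    induction if \<open>\<theta> * (\<alpha> * C + \<kappa> / (1 - \<theta>)) \<le> C\<close>. For
    this C the condition reads \<open>\<theta> * (\<alpha> + (1 - \<theta>)) \<le> 1\<close>, true
    for all \<open>\<alpha> \<le> 1\<close> because
    \<open>\<theta> * (2 - \<theta>) = 1 - (1 - \<theta>)^2\<close>.\<close>
  let ?C = "\<kappa> / (1 - \<theta>)\<^sup>2"
  let ?y = "snd ((skew G ^^ j) (x, y))" and ?y' = "snd ((skew G ^^ j) (x', y'))"
  let ?x = "(shift ^^ j) x" and ?x' = "(shift ^^ j) x'"
  have pw: "\<theta> ^ (n - j) = \<theta> * \<theta> ^ (n - Suc j)"
    using Suc.prems by (metis Suc_diff_Suc Suc_le_lessD power_Suc)
  have C: "0 \<le> ?C" using \<kappa> by simp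
  have factor: "\<alpha> * (\<alpha> ^ j + c * (\<theta> * t)) + c * (1 - \<theta>) * (\<theta> * t)
      = \<alpha> ^ Suc j + (c * t) * (\<theta> * (\<alpha> + (1 - \<theta>)))" for c t
    by (simp add: algebra_simps)
  have "dist (G (?x, ?y)) (G (?x', ?y')) \<le> dist (G (?x, ?y)) (G (?x, ?y')) + dist (G (?x, ?y')) (G (?x', ?y'))"
    by (rule dist_triangle)
  also have "\<dots> \<le> \<alpha> * dist ?y ?y' + \<kappa> * d_theta \<theta> ?x ?x'"
    using x by (intro add_mono contr lip shift_pow_in_shift_space)
  also have "\<dots> \<le> \<alpha> * (\<alpha> ^ j + ?C * \<theta> ^ (n - j)) + \<kappa> * (\<theta> ^ (n - j) / (1 - \<theta>))"
    using Suc \<alpha> \<kappa> d_theta_shift_pow_le[OF theta agree, where j = j] by (intro add_mono mult_left_mono) auto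
  also have "\<kappa> * (\<theta> ^ (n - j) / (1 - \<theta>)) = ?C * (1 - \<theta>) * \<theta> ^ (n - j)"
    using theta by (simp add: power2_eq_square)
  also have "\<alpha> * (\<alpha> ^ j + ?C * \<theta> ^ (n - j)) + ?C * (1 - \<theta>) * \<theta> ^ (n - j)
      = \<alpha> ^ Suc j + (?C * \<theta> ^ (n - Suc j)) * (\<theta> * (\<alpha> + (1 - \<theta>)))"
    unfolding pw by (rule factor)
  also have "\<dots> \<le> \<alpha> ^ Suc j + (?C * \<theta> ^ (n - Suc j)) * 1"
  proof (intro add_left_mono mult_left_mono)
    have "\<theta> * (\<alpha> + (1 - \<theta>)) \<le> \<theta> * (1 + (1 - \<theta>))" using theta \<alpha> by simp
    also have "\<dots> \<le> 1" using zero_le_power2[of "1 - \<theta>"] by (simp add: power2_eq_square algebra_simps)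
    finally show "\<theta> * (\<alpha> + (1 - \<theta>)) \<le> 1" .
  qed (use \<kappa> theta in simp)
  finally show ?case unfolding skew_pow_snd_Suc by simp
qed

section \<open>Functions measurable with respect to the \<sigma>-algebra of the base\<close>

lemma F0_sets:
  assumes gen: "\<G> \<subseteq> Pow (shift_space A)"
    and S: "S \<in> sets (F0 A \<G> :: ((nat \<Rightarrow> 'n::finite) \<times> 'k) measure)"
  obtains B where "B \<in> sigma_sets (shift_space A) \<G>" "S = B \<times> UNIV"
proof -
  have sa: "sigma_algebra (shift_space A) (sigma_sets (shift_space A) \<G>)"
    by (rule sigma_algebra_sigma_sets[OF gen])
  \<comment> \<open>The \<sigma>-algebra generated by \<G> is itself an algebra containing \<G>, so
    the generated algebra adds no new base sets.\<close>
  have hull: "algebra (shift_space A) hull \<G> \<subseteq> sigma_sets (shift_space A) \<G>"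
    using sa by (intro hull_minimal) (auto simp: sigma_algebra_def intro: sigma_sets.Basic)
  have "sets (F0 A \<G> :: ((nat \<Rightarrow> 'n) \<times> 'k) measure) =
    sigma_sets (shift_space A \<times> UNIV) ((\<lambda>B. B \<times> UNIV) ` (algebra (shift_space A) hull \<G>))"
    unfolding F0_def using hull sigma_sets_into_sp[OF gen]
    by (intro sets_measure_of) blast
  with S have "S \<in> sigma_sets (shift_space A \<times> UNIV) ((\<lambda>B. B \<times> UNIV) ` (algebra (shift_space A) hull \<G>))"
    by simp
  then have "\<exists>B\<in>sigma_sets (shift_space A) \<G>. S = B \<times> (UNIV :: 'k set)"
  proof induction
    case (Basic S)
    then show ?case using hull by blast
  next
    case Empty
    then show ?case by (intro bexI[of _ "{}"]) (auto intro: sigma_sets.Empty)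
  next
    case (Compl S)
    then obtain B where "B \<in> sigma_sets (shift_space A) \<G>" "S = B \<times> UNIV" by blast
    then show ?case by (intro bexI[of _ "shift_space A - B"]) (auto intro: sigma_sets.Compl)
  next
    case (Union S)
    then obtain B where "\<And>i. B i \<in> sigma_sets (shift_space A) \<G>" "\<And>i. S i = B i \<times> UNIV" by metis
    then show ?case by (intro bexI[of _ "\<Union>i. B i"]) (auto intro: sigma_sets.Union)
  qed
  then show ?thesis using that by blast
qed

text \<open>Level sets of \<psi> are unions of whole fibers, so \<psi> may be read off along any
  section; the constant section at \<open>undefined\<close> is measurable because it pulls
  \<open>B \<times> UNIV\<close> back to B.\<close>

lemma F0_measurable_factor:
  fixes \<psi> :: "(nat \<Rightarrow> 'n::finite) \<times> 'k \<Rightarrow> real"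
  assumes gen: "\<G> \<subseteq> Pow (shift_space A)"
    and m: "space m = shift_space A" "sets m = sigma_sets (shift_space A) \<G>"
    and \<psi>: "\<psi> \<in> borel_measurable (F0 A \<G>)"
  obtains f where "f \<in> borel_measurable m" "\<And>x y. x \<in> shift_space A \<Longrightarrow> \<psi> (x, y) = f x"
proof -
  let ?F = "F0 A \<G> :: ((nat \<Rightarrow> 'n) \<times> 'k) measure"
  have sp: "space ?F = shift_space A \<times> UNIV"
    unfolding F0_def by (simp add: space_measure_of_conv)
  have const: "\<psi> (x, y) = \<psi> (x, y')" if x: "x \<in> shift_space A" for x y y'
  proof -
    have "\<psi> -` {\<psi> (x, y)} \<inter> space ?F \<in> sets ?F"
      by (rule measurable_sets[OF \<psi>]) simp
    then obtain B where "\<psi> -` {\<psi> (x, y)} \<inter> space ?F = B \<times> UNIV"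
      using F0_sets[OF gen] by blast
    then have "(x, y') \<in> \<psi> -` {\<psi> (x, y)}" using x unfolding sp by blast
    then show ?thesis by simp
  qed
  have "(\<lambda>x. (x, undefined)) \<in> measurable m ?F"
  proof (rule measurableI)
    fix S assume "S \<in> sets ?F"
    then obtain B where B: "B \<in> sets m" "S = B \<times> UNIV"
      using F0_sets[OF gen] m by metis
    then have "(\<lambda>x. (x, undefined)) -` S \<inter> space m = B"
      using sets.sets_into_space[of B m] by auto
    then show "(\<lambda>x. (x, undefined)) -` S \<inter> space m \<in> sets m" using B by simp
  qed (auto simp: sp m)
  then have "(\<lambda>x. \<psi> (x, undefined)) \<in> borel_measurable m"
    by (rule measurable_compose[OF _ \<psi>])
  then show ?thesis using const by (intro that[of "\<lambda>x. \<psi> (x, undefined)"]) auto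
qed

section \<open>Decay of correlations\<close>

text \<open>A decay that advances only once in K steps is geometric with the K-th root as rate;
  rounding the exponent down costs at most one factor \<rho>.\<close>

lemma power_div_le_root_power:
  fixes \<rho> :: real
  assumes "0 < \<rho>" "\<rho> < 1" "0 < K"
  shows "\<rho> ^ (n div K) \<le> root K \<rho> ^ n / \<rho>"
proof -
  have "root K \<rho> ^ K = \<rho>" using assms by simp
  then have "\<rho> ^ (n div K) * \<rho> = root K \<rho> ^ (K * (n div K) + K)"
    by (simp only: power_add power_mult)
  also have "\<dots> \<le> root K \<rho> ^ n"
  proof (rule power_decreasing)
    show "n \<le> K * (n div K) + K"
      using mod_less_divisor[OF assms(3), of n] mult_div_mod_eq[of K n] by linarith
  qed (use assms in auto)
  finally show ?thesis using assms by (simp add: field_simps)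
qed

theorem theorem3:
  fixes A :: "nat^'n^'n" and \<theta> :: real and m :: "(nat \<Rightarrow> 'n) measure"
    and G :: "(nat \<Rightarrow> 'n) \<times> 'k::metric_space \<Rightarrow> 'k"
    and \<G> :: "(nat \<Rightarrow> 'n) set set"
    and \<mu>0 :: "((nat \<Rightarrow> 'n) \<times> 'k) measure"
  assumes A: "\<forall>i j. A $ i $ j \<in> {0, 1}" "aperiodic A"
    and theta: "0 < \<theta>" "\<theta> < 1"
    and m: "markov_measure \<theta> A m" "distr m m shift = m"
    and K: "compact (UNIV :: 'k set)" "diameter (UNIV :: 'k set) = 1"
    and G: "G \<in> measurable (skew_borel \<theta> A) borel" "G1 m G" "G2 \<theta> A G"
    and gen: "countable \<G>" "\<G> \<subseteq> Pow (shift_space A)"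
      "sigma_sets (shift_space A) \<G> = sets (metric_borel (shift_metric \<theta> A))"
    and mu0: "prob_space \<mu>0" "sets \<mu>0 = sets (skew_borel \<theta> A)"
      "distr \<mu>0 \<mu>0 (skew G) = \<mu>0" "measure \<mu>0 \<in> S_inf \<theta> A m"
  shows "\<exists>\<tau>3. 0 < \<tau>3 \<and> \<tau>3 < 1 \<and>
    (\<forall>\<psi> \<phi>. \<psi> \<in> borel_measurable (F0 A \<G>) \<longrightarrow> integrable \<mu>0 \<psi> \<longrightarrow>
       \<phi> \<in> lipschitz_functions (skew_metric \<theta> A) \<longrightarrow>
       (\<exists>D>0. \<forall>n\<ge>1.
          \<bar>(\<integral>p. \<psi> ((skew G ^^ n) p) * \<phi> p \<partial>\<mu>0) - (\<integral>p. \<psi> p \<partial>\<mu>0) * (\<integral>p. \<phi> p \<partial>\<mu>0)\<bar>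
            \<le> \<tau>3 ^ n * D))"
proof -
  obtain P :: "real^'n^'n" and p :: "real^'n" where
    P: "\<And>i j. 0 \<le> P $ i $ j" "\<And>i. (\<Sum>j\<in>UNIV. P $ i $ j) = 1" "\<And>i j. P $ i $ j > 0 \<longleftrightarrow> A $ i $ j = 1"
    and p: "\<And>i. 0 \<le> p $ i" "(\<Sum>i\<in>UNIV. p $ i) = 1"
    and cyl: "\<And>w n. measure m {x \<in> shift_space A. \<forall>i\<le>n. x i = w i} = p $ w 0 * (\<Prod>i<n. P $ w i $ w (Suc i))"
    using m(1) unfolding markov_measure_def by blast
  interpret m: prob_space m using m(1) by (simp add: markov_measure_def)
  interpret m: stationary_chain m \<theta> A P p
  proof unfold_locales
    show "sets m = sets (metric_borel (shift_metric \<theta> A))" using m(1) by (simp add: markov_measure_def)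
  qed (use theta cyl m(2) in \<open>auto simp: cyl_def\<close>)
  obtain k where k: "1 \<le> k" "\<And>i j. matpow A k $ i $ j > 0"
    using A(2) by (auto simp: aperiodic_def)
  have k_pos: "trans_pow P k i j > 0" for i j
  proof (rule trans_pow_pos[OF P(1) _ k(2)])
    fix i j assume "0 < A $ i $ j"
    then show "0 < P $ i $ j" using A(1)[rule_format, of i j] P(3)[of i j] by simp
  qed
  obtain r C where r: "0 < r" "r < 1" and p_pos: "\<And>j. p $ j > 0"
    and rate: "\<And>g i j. \<bar>trans_pow P g i j / p $ j - 1\<bar> \<le> C * r ^ (g div k)"
    using trans_pow_convergence[OF P(1,2) p m.stationary k_pos] by blast
  interpret m: positive_chain m \<theta> A P p by unfold_locales (rule p_pos)
  have C: "0 \<le> C" using order_trans[OF abs_ge_zero rate[of 0]] by simp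

  interpret \<mu>0: prob_space \<mu>0 by fact
  have space_\<mu>0: "space \<mu>0 = shift_space A \<times> UNIV"
    using sets_eq_imp_space_eq[OF mu0(2)] theta by (simp add: space_metric_borel)
  have F_meas: "skew G \<in> measurable \<mu>0 \<mu>0"
    using measurable_skew[OF theta K(1) G(1)] measurable_cong_sets[OF mu0(2) mu0(2)] by blast
  have fst_meas: "fst \<in> measurable \<mu>0 m"
    using measurable_fst_skew_borel[OF theta, where A = A] measurable_cong_sets[OF mu0(2) m.sets_m] by blast

  \<comment> \<open>This allows null sets of m to be pulled back to \<mu>0 and the integrability of
    \<psi> to be passed down to m.\<close>
  have marginal: "distr \<mu>0 m fst = m"
  proof -
    obtain f where f: "f \<in> lipschitz_functions (shift_metric \<theta> A)"
      "\<And>E. E \<in> sets m \<Longrightarrow> measure \<mu>0 (E \<times> UNIV) = (LINT x:E|m. f x)"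
      using mu0(4) unfolding S_inf_def mem_Collect_eq by blast
    show ?thesis
    proof (rule m.marginal_unique[OF mu0(1) fst_meas F_meas mu0(3) _ f(1) _ rate])
      show "fst (skew G q) = shift (fst q)" for q by (simp add: skew_apply)
      fix E assume E: "E \<in> sets m"
      then have "fst -` E \<inter> space \<mu>0 = E \<times> UNIV"
        using sets.sets_into_space[OF E] unfolding space_\<mu>0 m.space_m by auto
      then show "measure \<mu>0 (fst -` E \<inter> space \<mu>0) = (LINT x:E|m. f x)" using f(2)[OF E] by simp
    next
      have "filterlim (\<lambda>g. g div k) at_top sequentially"
        unfolding filterlim_at_top
      proof
        fix Z :: nat
        have "Z \<le> g div k" if "Z * k \<le> g" for g
          using div_le_mono[OF that, of k] k(1) by simp
        then show "eventually (\<lambda>g. Z \<le> g div k) sequentially"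
          by (rule eventually_sequentiallyI)
      qed
      moreover have "(\<lambda>g. r ^ g) \<longlonglongrightarrow> 0"
        using r by (intro LIMSEQ_realpow_zero) auto
      ultimately have "(\<lambda>g. r ^ (g div k)) \<longlonglongrightarrow> 0"
        by (rule filterlim_compose[rotated])
      then show "(\<lambda>g. C * r ^ (g div k)) \<longlonglongrightarrow> 0"
        by (rule tendsto_mult_right_zero)
    qed
  qed

  obtain \<alpha> where \<alpha>: "0 < \<alpha>" "\<alpha> < 1"
    and contr: "AE x in m. \<forall>y1 y2. dist (G (x, y1)) (G (x, y2)) \<le> \<alpha> * dist y1 y2"
    using G(2) by (auto simp: G1_def)
  \<comment> \<open>The exceptional set of (G1) has a null preimage under every iterate, m being
    invariant, and countably many null sets remain null: almost every x has a contracting fiber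
    along its whole orbit.\<close>
  have "AE x in m. \<forall>y1 y2. dist (G ((shift ^^ j) x, y1)) (G ((shift ^^ j) x, y2)) \<le> \<alpha> * dist y1 y2" for j
    using contr
    by (intro AE_distrD[OF m.shift_pow_measurable, where P = "\<lambda>x. \<forall>y1 y2. dist (G (x, y1)) (G (x, y2)) \<le> \<alpha> * dist y1 y2"])
      (simp only: m.distr_shift_pow)
  then have "AE x in m. \<forall>j y1 y2. dist (G ((shift ^^ j) x, y1)) (G ((shift ^^ j) x, y2)) \<le> \<alpha> * dist y1 y2"
    by (simp add: AE_all_countable)
  then have orbit_contr: "AE q in \<mu>0. \<forall>j y1 y2.
      dist (G ((shift ^^ j) (fst q), y1)) (G ((shift ^^ j) (fst q), y2)) \<le> \<alpha> * dist y1 y2"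
    by (intro AE_distrD[OF fst_meas, where P = "\<lambda>x. \<forall>j y1 y2.
        dist (G ((shift ^^ j) x, y1)) (G ((shift ^^ j) x, y2)) \<le> \<alpha> * dist y1 y2"]) (simp only: marginal)
  obtain \<kappa> where \<kappa>: "0 \<le> \<kappa>"
    and lip: "\<And>y x1 x2. x1 \<in> shift_space A \<Longrightarrow> x2 \<in> shift_space A \<Longrightarrow>
      dist (G (x1, y)) (G (x2, y)) \<le> \<kappa> * d_theta \<theta> x1 x2"
  proof -
    obtain ky where ky: "\<And>y. ky y \<ge> 0" "\<And>y x1 x2. x1 \<in> shift_space A \<Longrightarrow> x2 \<in> shift_space A \<Longrightarrow>
        dist (G (x1, y)) (G (x2, y)) \<le> ky y * d_theta \<theta> x1 x2" "bdd_above (range ky)"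
      using G(3) unfolding G2_def by blast
    obtain \<kappa> where \<kappa>: "\<And>y. ky y \<le> \<kappa>" using ky(3) by (auto simp: bdd_above_def)
    show ?thesis
    proof (rule that)
      show "0 \<le> \<kappa>" using ky(1) \<kappa> order_trans by blast
      fix y x1 x2 assume x: "x1 \<in> shift_space A" "x2 \<in> shift_space A"
      show "dist (G (x1, y)) (G (x2, y)) \<le> \<kappa> * d_theta \<theta> x1 x2"
        using ky(2)[OF x, of y] mult_right_mono[OF \<kappa>[of y] d_theta_nonneg[OF theta, of x1 x2]] by linarith
    qed
  qed
  have diam: "dist y1 y2 \<le> 1" for y1 y2 :: 'k
    using diameter_bounded_bound[OF compact_imp_bounded[OF K(1)], of y1 y2] K(2) by simp

  \<comment> \<open>The slowest of three rates: mixing of the chain, contraction of the fibers, and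
    truncation of the base point to finitely many letters.\<close>
  define \<rho> where "\<rho> = max r (max \<alpha> \<theta>)"
  have \<rho>: "0 < \<rho>" "\<rho> < 1" using r \<alpha> theta by (auto simp: \<rho>_def)
  have le_\<rho>: "s ^ a \<le> \<rho> ^ b" if "0 \<le> s" "s \<le> \<rho>" "b \<le> a" for s :: real and a b :: nat
    using order_trans[OF power_mono[OF that(2,1)] power_decreasing[OF that(3)]] \<rho> by simp
  \<comment> \<open>The factor 2 accounts for the gap being only about n/2 long, the factor k for
    the chain contracting once in k steps.\<close>
  define \<tau> where "\<tau> = root (2 * k) \<rho>"
  have K0: "0 < 2 * k" using k(1) by simp
  have \<tau>: "0 < \<tau>" "\<tau> < 1"
    using \<rho> K0 by (auto simp: \<tau>_def)

  have decay: "\<exists>D>0. \<forall>n\<ge>1.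
      \<bar>(\<integral>p. \<psi> ((skew G ^^ n) p) * \<phi> p \<partial>\<mu>0) - (\<integral>p. \<psi> p \<partial>\<mu>0) * (\<integral>p. \<phi> p \<partial>\<mu>0)\<bar> \<le> \<tau> ^ n * D"
    if \<psi>: "\<psi> \<in> borel_measurable (F0 A \<G>)" "integrable \<mu>0 \<psi>"
      and \<phi>: "\<phi> \<in> lipschitz_functions (skew_metric \<theta> A)" for \<psi> \<phi>
  proof -
    obtain f where f: "f \<in> borel_measurable m" "\<And>x y. x \<in> shift_space A \<Longrightarrow> \<psi> (x, y) = f x"
      using F0_measurable_factor[OF gen(2) m.space_m _ \<psi>(1)] gen(3) m.sets_m by metis
    have \<psi>_eq: "\<psi> q = f (fst q)" if "q \<in> space \<mu>0" for q
      using f(2) that by (cases q) (auto simp: space_\<mu>0)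
    have "integrable \<mu>0 (\<lambda>q. f (fst q))"
      using \<psi>(2) by (rule Bochner_Integration.integrable_cong[THEN iffD1, rotated 2]) (auto simp: \<psi>_eq)
    then have f_int: "integrable m f"
      using integrable_distr_eq[OF fst_meas f(1)] marginal by simp
    have \<psi>_integral: "(\<integral>q. \<psi> q \<partial>\<mu>0) = (\<integral>x. f x \<partial>m)"
    proof -
      have "(\<integral>q. \<psi> q \<partial>\<mu>0) = (\<integral>q. f (fst q) \<partial>\<mu>0)"
        by (intro Bochner_Integration.integral_cong) (auto simp: \<psi>_eq)
      then show ?thesis using integral_distr[OF fst_meas f(1)] marginal by simp
    qed
    have \<phi>_meas: "\<phi> \<in> borel_measurable \<mu>0"
      using lipschitz_functions_measurable[OF \<phi>] measurable_cong_sets[OF mu0(2) refl] by blast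
    obtain L where L: "0 < L" "\<And>q q'. q \<in> shift_space A \<times> UNIV \<Longrightarrow> q' \<in> shift_space A \<times> UNIV \<Longrightarrow>
        \<bar>\<phi> q - \<phi> q'\<bar> \<le> L * d_sum \<theta> q q'"
      using lipschitz_functionsE[OF \<phi>] theta by (metis skew_metric_simps)
    have "d_sum \<theta> q q' \<le> 1 / (1 - \<theta>) + 1" for q q' :: "(nat \<Rightarrow> 'n) \<times> 'k"
      using d_theta_agree_le[OF theta, of 0 "fst q" "fst q'"] diam[of "snd q" "snd q'"] by (simp add: d_sum_def)
    then obtain B where B: "0 \<le> B" "\<And>q. q \<in> shift_space A \<times> UNIV \<Longrightarrow> \<bar>\<phi> q\<bar> \<le> B"
      using bounded_lipschitz_function[OF \<phi>, of "1 / (1 - \<theta>) + 1"] theta by (metis skew_metric_simps)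
    \<comment> \<open>The factor \<open>2 * \<epsilon> + B * \<delta>\<close> of the mixing
      estimate, with the common exponential bound taken out of every term.\<close>
    define Z where "Z = 2 * (L * (1 / (1 - \<theta>) + (1 + \<kappa> / (1 - \<theta>)\<^sup>2))) + B * C"
    have Z: "0 \<le> Z" unfolding Z_def using L(1) theta \<kappa> B(1) C by (intro add_nonneg_nonneg mult_nonneg_nonneg) auto
    have N: "0 \<le> (\<integral>x. \<bar>f x\<bar> \<partial>m)" by simp
    have bound: "\<bar>(\<integral>p. \<psi> ((skew G ^^ n) p) * \<phi> p \<partial>\<mu>0) - (\<integral>p. \<psi> p \<partial>\<mu>0) * (\<integral>p. \<phi> p \<partial>\<mu>0)\<bar>
        \<le> \<rho> ^ (n div (2 * k)) * (Z * (\<integral>x. \<bar>f x\<bar> \<partial>m))" for n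
    proof -
      \<comment> \<open>Knowing the letters up to n + l leaves those up to l known after n shifts,
        and the gap g is at least l.\<close>
      define l where "l = n div 2"
      define g where "g = n - l"
      have lg: "(n + l) + g = n + n" by (simp add: l_def g_def)
      let ?F = "skew G ^^ n"
      have Fn_meas: "?F \<in> measurable \<mu>0 \<mu>0" by (rule measurable_compose_n[OF F_meas])
      have Fn_distr: "distr \<mu>0 \<mu>0 ?F = \<mu>0" by (rule distr_funpow[OF F_meas mu0(3)])
      have \<psi>Fn_meas: "(\<lambda>q. \<psi> (?F q)) \<in> borel_measurable \<mu>0"
        by (rule measurable_compose[OF Fn_meas borel_measurable_integrable[OF \<psi>(2)]])
      let ?U = "\<lambda>q. \<phi> (?F q)"
      have "(\<integral>q. \<psi> (?F q) * \<phi> q \<partial>\<mu>0) = (\<integral>q. \<psi> (?F q) * \<phi> q \<partial>distr \<mu>0 \<mu>0 ?F)"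
        by (simp only: Fn_distr)
      also have "\<dots> = (\<integral>q. \<psi> (?F (?F q)) * ?U q \<partial>\<mu>0)"
        by (rule integral_distr[OF Fn_meas borel_measurable_times[OF \<psi>Fn_meas \<phi>_meas]])
      also have "\<dots> = (\<integral>q. f ((shift ^^ ((n + l) + g)) (fst q)) * ?U q \<partial>\<mu>0)"
      proof (intro Bochner_Integration.integral_cong refl)
        fix q assume "q \<in> space \<mu>0"
        then have "?F (?F q) \<in> space \<mu>0" using measurable_space[OF Fn_meas] by blast
        then have "\<psi> (?F (?F q)) = f ((shift ^^ (n + n)) (fst q))"
          by (simp add: \<psi>_eq skew_pow_fst funpow_add)
        then show "\<psi> (?F (?F q)) * ?U q = f ((shift ^^ ((n + l) + g)) (fst q)) * ?U q" by (simp only: lg)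
      qed
      finally have 1: "(\<integral>q. \<psi> (?F q) * \<phi> q \<partial>\<mu>0)
          = (\<integral>q. f ((shift ^^ ((n + l) + g)) (fst q)) * ?U q \<partial>\<mu>0)" .
      have 2: "(\<integral>q. \<phi> q \<partial>\<mu>0) = (\<integral>q. ?U q \<partial>\<mu>0)"
        using integral_distr[OF Fn_meas \<phi>_meas] by (simp only: Fn_distr)
      \<comment> \<open>After n contracting steps the starting point in the fiber hardly matters, so
        any fixed one will do; \<open>undefined\<close> stands for it.\<close>
      define u where "u = (\<lambda>x. \<phi> (?F (x, undefined)))"
      define \<epsilon> where "\<epsilon> = L * (\<theta> ^ l / (1 - \<theta>) + (\<alpha> ^ n + \<kappa> / (1 - \<theta>)\<^sup>2 * \<theta> ^ l))"
      have F_in: "?F q \<in> shift_space A \<times> UNIV" if "q \<in> shift_space A \<times> UNIV" for q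
        using measurable_space[OF Fn_meas] that by (simp only: space_\<mu>0)
      have approx: "AE q in \<mu>0. \<bar>?U q - word_value A (n + l) u (restrict (fst q) {..n + l})\<bar> \<le> \<epsilon>"
        using orbit_contr AE_space
      proof eventually_elim
        case (elim q)
        then have q: "fst q \<in> shift_space A" by (auto simp: space_\<mu>0)
        then obtain x' where x': "x' \<in> shift_space A" "\<And>i. i \<le> n + l \<Longrightarrow> fst q i = x' i"
          "word_value A (n + l) u (restrict (fst q) {..n + l}) = u x'"
          using word_value_restrict[of "fst q" A "n + l" u] by metis
        let ?q' = "(x', undefined)"
        have "\<bar>?U q - \<phi> (?F ?q')\<bar> \<le> L * d_sum \<theta> (?F q) (?F ?q')"
          using q x'(1) by (intro L(2) F_in) (auto simp: mem_Times_iff)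
        also have "\<dots> \<le> \<epsilon>"
          unfolding \<epsilon>_def d_sum_def
        proof (intro mult_left_mono add_mono)
          show "d_theta \<theta> (fst (?F q)) (fst (?F ?q')) \<le> \<theta> ^ l / (1 - \<theta>)"
            using d_theta_shift_pow_le[OF theta, of "n + l" "fst q" x' n] x'(2) by (simp add: skew_pow_fst)
          show "dist (snd (?F q)) (snd (?F ?q')) \<le> \<alpha> ^ n + \<kappa> / (1 - \<theta>)\<^sup>2 * \<theta> ^ l"
          proof -
            \<comment> \<open>The contracting orbit is that of q, which is generic; the sampled
              point x' may well lie in the exceptional null set.\<close>
            have "dist (snd (?F (fst q, snd q))) (snd (?F ?q')) \<le> \<alpha> ^ n + \<kappa> / (1 - \<theta>)\<^sup>2 * \<theta> ^ (n + l - n)"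
              by (rule fiber_dist_le[OF theta _ _ \<kappa> diam q x'(1) elim(1)[rule_format] lip x'(2)])
                (use \<alpha> in auto)
            then show ?thesis by simp
          qed
        qed (use L(1) in auto)
        finally show ?case using x'(3) by (simp add: u_def)
      qed
      have word_bound: "\<bar>word_value A (n + l) u w\<bar> \<le> B" for w
        using B F_in by (intro word_value_bound) (auto simp: u_def)
      have "\<bar>(\<integral>q. f ((shift ^^ ((n + l) + g)) (fst q)) * ?U q \<partial>\<mu>0) - (\<integral>x. f x \<partial>m) * (\<integral>q. ?U q \<partial>\<mu>0)\<bar>
          \<le> (2 * \<epsilon> + B * (C * r ^ (g div k))) * (\<integral>x. \<bar>f x\<bar> \<partial>m)"
        by (rule m.mixing_approx[OF mu0(1) fst_meas marginal f_int word_bound rate _ approx])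
          (rule measurable_compose[OF Fn_meas \<phi>_meas])
      also have "\<dots> \<le> (\<rho> ^ (n div (2 * k)) * Z) * (\<integral>x. \<bar>f x\<bar> \<partial>m)"
      proof (rule mult_right_mono[OF _ N])
        let ?t = "\<rho> ^ (n div (2 * k))"
        \<comment> \<open>All exponents that occur, namely l, n and \<open>g div k\<close>, are at
          least \<open>l div k\<close>.\<close>
        have nk: "n div (2 * k) = l div k" by (simp add: l_def div_mult2_eq)
        have "l div k \<le> l" by simp
        then have th: "\<theta> ^ l \<le> ?t" unfolding nk using theta by (intro le_\<rho>) (auto simp: \<rho>_def)
        have al: "\<alpha> ^ n \<le> ?t" using \<alpha> by (intro le_\<rho>) (auto simp: \<rho>_def)
        have "l div k \<le> g div k" by (intro div_le_mono) (simp add: g_def l_def)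
        then have rr: "r ^ (g div k) \<le> ?t" unfolding nk using r by (intro le_\<rho>) (auto simp: \<rho>_def)
        have "2 * \<epsilon> + B * (C * r ^ (g div k))
            \<le> 2 * (L * (?t / (1 - \<theta>) + (?t + \<kappa> / (1 - \<theta>)\<^sup>2 * ?t))) + B * (C * ?t)"
          unfolding \<epsilon>_def using th al rr L(1) theta \<kappa> B(1) C
          by (intro add_mono mult_left_mono divide_right_mono) auto
        also have "\<dots> = ?t * Z" by (simp add: Z_def algebra_simps)
        finally show "2 * \<epsilon> + B * (C * r ^ (g div k)) \<le> ?t * Z" .
      qed
      finally show ?thesis by (simp only: 1 2 \<psi>_integral mult.assoc)
    qed
    \<comment> \<open>The division by \<rho> pays for rounding the exponent; the summand 1 keeps D
      positive when f vanishes almost everywhere.\<close>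
    let ?D = "Z * (\<integral>x. \<bar>f x\<bar> \<partial>m) / \<rho> + 1"
    have "\<bar>(\<integral>p. \<psi> ((skew G ^^ n) p) * \<phi> p \<partial>\<mu>0) - (\<integral>p. \<psi> p \<partial>\<mu>0) * (\<integral>p. \<phi> p \<partial>\<mu>0)\<bar> \<le> \<tau> ^ n * ?D" for n
    proof -
      note bound[of n]
      also have "\<rho> ^ (n div (2 * k)) * (Z * (\<integral>x. \<bar>f x\<bar> \<partial>m)) \<le> \<tau> ^ n / \<rho> * (Z * (\<integral>x. \<bar>f x\<bar> \<partial>m))"
        using power_div_le_root_power[OF \<rho> K0, of n] Z N unfolding \<tau>_def by (intro mult_right_mono) auto
      also have "\<dots> \<le> \<tau> ^ n * ?D" using \<tau> by (simp add: distrib_left)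
      finally show ?thesis .
    qed
    moreover have "0 < ?D" using Z N \<rho> by (intro add_nonneg_pos divide_nonneg_pos mult_nonneg_nonneg) auto
    ultimately show ?thesis by blast
  qed
  show ?thesis using \<tau> decay by blast
qed

end
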